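(* Let $\bar L$ be a birth and death generator on $\mathbb{Z}_+$, absorbing at $0$ and irreducible on $\mathbb{N}=\{1,2,3,\dots\}$, for which $\infty$ is an entrance boundary. Then $\lambda_0'>\lambda_0$ and $$\sum_{n\in\mathbb{Z}_+}\frac1{\lambda_n}<+\infty.$$ In particular, $$\Big(1-\frac{\lambda_0}{\lambda_0'}\Big)\prod_{n\in\mathbb{N}}\Big(1-\frac{\lambda_0}{\lambda_n}\Big)>0.$$ Up to a change of sign, the eigenvector $\varphi$ is increasing on $\mathbb{Z}_+$ (with the convention $\varphi(0)=0$). It is furthermore bounded and its amplitude satisfies $$\frac{\sup_{x\in\mathbb{N}}\varphi(x)}{\inf_{y\in\mathbb{N}}\varphi(y)}=\frac{\lim_{x\to\infty}\varphi(x)}{\varphi(1)}\le\left(\Big(1-\frac{\lambda_0}{\lambda_0'}\Big)\prod_{n\in\mathbb{N}}\Big(1-\frac{\lambda_0}{\lambda_n}\Big)\right)^{-1}.$$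
   Context: $\mathbb{Z}_+=\{0,1,2,\dots\}$, $\mathbb{N}=\{1,2,3,\dots\}$. The generator $\bar L$ is given by $\bar L(x,x+1)=b_x$, $\bar L(x,x-1)=d_x$ (for $x\ge1$), $\bar L(x,x)=-d_x-b_x$ (with $d_0=0$), and $\bar L(x,y)=0$ otherwise, where $b_x>0$ and $d_x>0$ for all $x\in\mathbb{N}$, and $b_0=0$ (so $0$ is absorbing). Define $\pi_1:=1$ and $\pi_x:=\dfrac{b_1b_2\cdots b_{x-1}}{d_2d_3\cdots d_x}$ for $x\ge2$. The boundary point $\infty$ is an entrance boundary for $\bar L$ if $$\sum_{x=1}^\infty\frac1{\pi_xb_x}\sum_{y=1}^x\pi_y=+\infty\quad\text{and}\quad\sum_{x=1}^\infty\frac1{\pi_xb_x}\sum_{y=x+1}^\infty\pi_y<+\infty.$$ Under this condition $Z:=\sum_{x\in\mathbb{N}}\pi_x<+\infty$, and $\eta(x):=Z^{-1}\pi_x$ is a probability on $\mathbb{N}$. Let $\mathcal{F}$ be the space of functions on $\mathbb{N}$ vanishing outside a finite subset (extended by $0$ at the point $0$), and $K$ the restriction of $\bar L$ to $\mathcal{F}$, which is symmetric in $\mathbb{L}^2(\eta)$. Still denote by $K$ its Friedrichs extension, a self-adjoint operator in $\mathbb{L}^2(\eta)$ (under the entrance boundary condition the self-adjoint extension is unique). It is known that the spectrum of $-K$ consists only of eigenvalues of multiplicity one, denoted $(\lambda_n)_{n\in\mathbb{Z}_+}$ in increasing order, with $\lambda_0>0$. $\varphi$ denotes an eigenvector associated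 to the eigenvalue $\lambda_0$ of $-K$. $\lambda_0':=\lambda_0(\mathbb{N}\setminus\{1\})$ is the first (smallest) eigenvalue of the restriction of $-K$ to functions which vanish at $1$ (i.e. of minus the analogous self-adjoint operator on $\mathbb{N}\setminus\{1\}$ with Dirichlet condition at $1$). *)

theory Defs
  imports "HOL-Analysis.Analysis"
begin

definition bd_generator :: "(nat \<Rightarrow> real) \<Rightarrow> (nat \<Rightarrow> real) \<Rightarrow> nat \<Rightarrow> nat \<Rightarrow> real" where
  "bd_generator b d x y =
     (if y = x + 1 then b x else if x = y + 1 then d x else if y = x then - d x - b x else 0)"

(* The row of x vanishes beyond x + 1, so the finite sum is the full action on functions. *)
definition bd_apply :: "(nat \<Rightarrow> real) \<Rightarrow> (nat \<Rightarrow> real) \<Rightarrow> (nat \<Rightarrow> real) \<Rightarrow> nat \<Rightarrow> real" where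
  "bd_apply b d f x = (\<Sum>y\<le>x + 1. bd_generator b d x y * f y)"

(* Only meaningful for x \<ge> 1; both products are empty at x = 1. *)
definition bd_pi :: "(nat \<Rightarrow> real) \<Rightarrow> (nat \<Rightarrow> real) \<Rightarrow> nat \<Rightarrow> real" where
  "bd_pi b d x = (\<Prod>i=1..<x. b i) / (\<Prod>i=2..x. d i)"

(* Sums are taken in ennreal, so that divergent inner or outer sums have the value \<infinity>. *)
definition entrance_boundary :: "(nat \<Rightarrow> real) \<Rightarrow> (nat \<Rightarrow> real) \<Rightarrow> bool" where
  "entrance_boundary b d \<longleftrightarrow>
     (\<Sum>\<^sub>\<infinity>x\<in>{1..}. ennreal (1 / (bd_pi b d x * b x)) * (\<Sum>y=1..x. ennreal (bd_pi b d y))) = \<infinity> \<and>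
     (\<Sum>\<^sub>\<infinity>x\<in>{1..}. ennreal (1 / (bd_pi b d x * b x)) * (\<Sum>\<^sub>\<infinity>y\<in>{x+1..}. ennreal (bd_pi b d y))) < \<infinity>"

definition bd_eta :: "(nat \<Rightarrow> real) \<Rightarrow> (nat \<Rightarrow> real) \<Rightarrow> nat \<Rightarrow> real" where
  "bd_eta b d x = bd_pi b d x / (\<Sum>\<^sub>\<infinity>y\<in>{1..}. bd_pi b d y)"

(* Functions on a set S of states are represented by their extension by 0 to all of nat. *)

definition l2 :: "nat set \<Rightarrow> (nat \<Rightarrow> real) \<Rightarrow> (nat \<Rightarrow> real) set" where
  "l2 S m = {f. (\<forall>x. x \<notin> S \<longrightarrow> f x = 0) \<and> (\<lambda>x. m x * (f x)\<^sup>2) summable_on S}"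

definition l2_inner :: "nat set \<Rightarrow> (nat \<Rightarrow> real) \<Rightarrow> (nat \<Rightarrow> real) \<Rightarrow> (nat \<Rightarrow> real) \<Rightarrow> real" where
  "l2_inner S m f g = (\<Sum>\<^sub>\<infinity>x\<in>S. m x * f x * g x)"

definition fin_supp :: "nat set \<Rightarrow> (nat \<Rightarrow> real) set" where
  "fin_supp S = {f. finite {x. f x \<noteq> 0} \<and> {x. f x \<noteq> 0} \<subseteq> S}"

(* The sequence u in the domain D of A exhibits f as an element of the domain of the closure of
   the quadratic form (g, h) \<mapsto> (A g, h): it converges to f in l2 and is Cauchy for the form. *)
definition form_approx ::
  "nat set \<Rightarrow> (nat \<Rightarrow> real) \<Rightarrow> (nat \<Rightarrow> real) set \<Rightarrow> ((nat \<Rightarrow> real) \<Rightarrow> nat \<Rightarrow> real)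
     \<Rightarrow> (nat \<Rightarrow> nat \<Rightarrow> real) \<Rightarrow> (nat \<Rightarrow> real) \<Rightarrow> bool" where
  "form_approx S m D A u f \<longleftrightarrow>
     f \<in> l2 S m \<and> (\<forall>n. u n \<in> D) \<and>
     (\<lambda>n. l2_inner S m (\<lambda>x. u n x - f x) (\<lambda>x. u n x - f x)) \<longlonglongrightarrow> 0 \<and>
     (\<forall>e>0. \<exists>N. \<forall>i\<ge>N. \<forall>j\<ge>N.
        l2_inner S m (A (\<lambda>x. u i x - u j x)) (\<lambda>x. u i x - u j x) < e)"

(* Graph of the Friedrichs extension of a symmetric nonnegative operator A with domain D: the
   operator associated with the closure q of the form of A, that is, (f, h) is in the graph iff f
   is in the form domain and q(f, g) = (h, g) for all g in the form domain. The value q(f, g) is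
   the limit of (A u_n, v_n) along any approximating sequences u of f and v of g. *)
definition friedrichs ::
  "nat set \<Rightarrow> (nat \<Rightarrow> real) \<Rightarrow> (nat \<Rightarrow> real) set \<Rightarrow> ((nat \<Rightarrow> real) \<Rightarrow> nat \<Rightarrow> real)
     \<Rightarrow> ((nat \<Rightarrow> real) \<times> (nat \<Rightarrow> real)) set" where
  "friedrichs S m D A =
     {(f, h). h \<in> l2 S m \<and> (\<exists>u. form_approx S m D A u f) \<and>
        (\<forall>g u v. form_approx S m D A u f \<longrightarrow> form_approx S m D A v g \<longrightarrow>
           (\<lambda>n. l2_inner S m (A (u n)) (v n)) \<longlonglongrightarrow> l2_inner S m h g)}"

definition minus_K0 :: "(nat \<Rightarrow> real) \<Rightarrow> (nat \<Rightarrow> real) \<Rightarrow> nat set \<Rightarrow> (nat \<Rightarrow> real) \<Rightarrow> nat \<Rightarrow> real" where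
  "minus_K0 b d S f x = (if x \<in> S then - bd_apply b d f x else 0)"

(* Self-adjoint realisation of minus the generator in l2 over S, with Dirichlet condition
   outside S: S = {1..} gives -K, and S = {1..} - {1} its restriction to functions vanishing at 1. *)
definition minus_K ::
  "(nat \<Rightarrow> real) \<Rightarrow> (nat \<Rightarrow> real) \<Rightarrow> nat set \<Rightarrow> ((nat \<Rightarrow> real) \<times> (nat \<Rightarrow> real)) set" where
  "minus_K b d S = friedrichs S (bd_eta b d) (fin_supp S) (minus_K0 b d S)"

definition is_eigenvector ::
  "((nat \<Rightarrow> real) \<times> (nat \<Rightarrow> real)) set \<Rightarrow> real \<Rightarrow> (nat \<Rightarrow> real) \<Rightarrow> bool" where
  "is_eigenvector G \<mu> f \<longleftrightarrow> f \<noteq> (\<lambda>x. 0) \<and> (f, \<lambda>x. \<mu> * f x) \<in> G"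

definition eigenvalues :: "((nat \<Rightarrow> real) \<times> (nat \<Rightarrow> real)) set \<Rightarrow> real set" where
  "eigenvalues G = {\<mu>. \<exists>f. is_eigenvector G \<mu> f}"

end

theory Submission
  imports Defs "HOL-Computational_Algebra.Polynomial"
begin

text \<open>
  Write \<open>a z\<close> for the conductance of the edge between \<open>z\<close> and \<open>z + 1\<close> and \<open>m x\<close> for the
  stationary mass, so that the form of minus the generator is the sum of \<open>a z * (f (z + 1) - f z)\<^sup>2\<close>.
  Let \<open>s x\<close> be the total resistance between \<open>0\<close> and \<open>x\<close>. The entrance boundary condition says that
  \<open>s\<close> is unbounded while the sum of \<open>m * s\<close> is finite.

  For a spectral parameter \<open>l\<close> let \<open>v l\<close> be the solution of the eigenvalue recurrence that starts at
  \<open>0\<close> with unit flux, and let \<open>F l\<close> be its flux. The growth bound \<open>v_bound\<close>,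
  \<open>\<bar>v l x\<bar> \<le> s x * exp (\<bar>l\<bar> * total)\<close>, implies that the flux has a limit \<open>flux_limit l\<close>, which is
  also the limit of \<open>v l x / s x\<close>. This entire function of \<open>l\<close> is the characteristic function of the
  problem: \<open>l\<close> is an eigenvalue iff \<open>flux_limit l = 0\<close>, and every eigenvector is then a multiple of
  \<open>v l\<close>. Indeed a solution of finite energy must lose its flux at infinity, because the resistance
  is infinite (\<open>flux_limit_zero_if_energy\<close>); conversely, a solution without flux at infinity is
  bounded (\<open>v_bounded\<close>), and bounded functions of finite energy are limits of finitely supported
  ones by cutoffs (\<open>exists_approx\<close>).

  For fixed \<open>n\<close>, \<open>v l (n + 1)\<close> is a polynomial in \<open>l\<close> of degree \<open>n\<close>. By Sturm's argument
  (\<open>sturm_step\<close>) it has \<open>n\<close> positive roots, the truncated eigenvalues, which interlace with those for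
  \<open>n + 1\<close> and hence decrease in \<open>n\<close>. Comparison of its factorisation with the growth bound at
  \<open>l = -1\<close> bounds the sum of the reciprocal roots uniformly in \<open>n\<close>. The limits \<open>ev 0 \<le> ev 1 \<le> \<dots>\<close>
  of the roots are therefore positive with summable reciprocals, and by the factorisation they are
  exactly the zeros of \<open>flux_limit\<close>. They are distinct, because at a double zero
  Lagrange's identity would force the squared norm of the eigenvector to vanish (\<open>ev_less_ev_Suc\<close>). So \<open>ev\<close>
  enumerates the spectrum. At the lowest eigenvalue no \<open>v l (n + 1)\<close> has changed its sign yet; thus the
  ground state is positive, its flux, a tail sum of positive terms, is positive too, and the ground
  state increases.

  The chain killed at \<open>1\<close> is a chain of the same kind, with all indices shifted by one. The
  Wronskian of its shooting solution \<open>killed_v l\<close> and \<open>v l\<close> is constant, and this has three uses.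
  Its sign excludes that the killed chain has the smaller lowest eigenvalue (\<open>ev_less_killed_ev\<close>).
  At infinity it identifies the ratio of \<open>v l 1\<close> to the limit of \<open>v l\<close>, for the ground state, with the value of the
  characteristic function of the killed chain (\<open>killed_flux_limit_eq\<close>). Finally it shows that the
  truncated eigenvalues of the killed chain separate those of the chain, so that in the factorised form of
  that value each factor but the first is at least \<open>1 - ev 0 / ev k\<close> (\<open>killed_v_lower_bound\<close>).
  The last two facts give the amplitude estimate (\<open>ground_state_amplitude\<close>).
\<close>

section \<open>Real-rootedness from alternating signs\<close>

lemma prod_one_minus_ge:
  fixes t :: "nat \<Rightarrow> real"
  assumes "finite A" "\<And>j. j \<in> A \<Longrightarrow> 0 \<le> t j \<and> t j \<le> 1"
  shows "1 - (\<Sum>j\<in>A. t j) \<le> (\<Prod>j\<in>A. 1 - t j)"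
  using assms
proof (induction A rule: finite_induct)
  case (insert j A)
  have p: "0 \<le> (\<Prod>j\<in>A. 1 - t j)" "(\<Prod>j\<in>A. 1 - t j) \<le> 1"
    using insert by (auto intro!: prod_nonneg prod_le_1)
  have IH: "1 - (\<Sum>j\<in>A. t j) \<le> (\<Prod>j\<in>A. 1 - t j)" using insert by auto
  have "t j * (\<Prod>j\<in>A. 1 - t j) \<le> t j"
    using p insert.prems[of j] by (intro mult_left_le) auto
  then show ?case using insert IH by (simp add: algebra_simps)
qed simp

lemma sum_le_prod_one_plus:
  fixes t :: "nat \<Rightarrow> real"
  assumes "finite A" "\<And>j. j \<in> A \<Longrightarrow> 0 \<le> t j"
  shows "1 + (\<Sum>j\<in>A. t j) \<le> (\<Prod>j\<in>A. 1 + t j)"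
  using assms
proof (induction A rule: finite_induct)
  case (insert j A)
  have IH: "1 + (\<Sum>j\<in>A. t j) \<le> (\<Prod>j\<in>A. 1 + t j)" using insert by auto
  have "0 \<le> (\<Sum>j\<in>A. t j)" using insert by (auto intro!: sum_nonneg)
  then have "t j * 1 \<le> t j * (\<Prod>j\<in>A. 1 + t j)"
    using insert.prems[of j] IH by (intro mult_left_mono) auto
  then show ?case using insert IH by (simp add: algebra_simps)
qed simp

lemma prod_one_plus_le_exp:
  fixes t :: "nat \<Rightarrow> real"
  assumes "finite A" "\<And>j. j \<in> A \<Longrightarrow> 0 \<le> t j"
  shows "(\<Prod>j\<in>A. 1 + t j) \<le> exp (\<Sum>j\<in>A. t j)"
  unfolding exp_sum[OF assms(1)]
  using assms by (intro prod_mono) (auto intro: add_nonneg_nonneg)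

lemma poly_eq_prod_roots:
  fixes p :: "real poly"
  assumes deg: "degree p \<le> n" and inj: "inj_on \<rho> {..<n}"
    and root: "\<And>j. j < n \<Longrightarrow> poly p (\<rho> j) = 0" and nz: "\<And>j. j < n \<Longrightarrow> \<rho> j \<noteq> 0"
  shows "poly p x = poly p 0 * (\<Prod>j<n. 1 - x / \<rho> j)"
proof -
  define q where "q = (\<Prod>j<n. [:1, - 1 / \<rho> j:])"
  have dq: "degree q \<le> n"
  proof -
    have "degree q \<le> (\<Sum>j<n. degree [:1, - 1 / \<rho> j:])"
      unfolding q_def using degree_prod_sum_le[of "{..<n}" "\<lambda>j. [:1, - 1 / \<rho> j:]"]
      by (simp only: o_def finite_lessThan)
    also have "\<dots> \<le> (\<Sum>j<n. 1)" by (intro sum_mono) (simp add: degree_pCons_eq_if)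
    finally show ?thesis by simp
  qed
  have q: "poly q y = (\<Prod>j<n. 1 - y / \<rho> j)" for y
    by (simp add: q_def poly_prod)
  define r where "r = p - smult (poly p 0) q"
  have "r = 0"
  proof (rule ccontr)
    assume "r \<noteq> 0"
    have sub: "insert 0 (\<rho> ` {..<n}) \<subseteq> {x. poly r x = 0}"
      using root nz by (auto simp: r_def q intro!: disjI2)
    have "Suc n = card (insert 0 (\<rho> ` {..<n}))"
      using inj nz by (subst card_insert_disjoint) (auto simp: card_image)
    also have "\<dots> \<le> card {x. poly r x = 0}"
      using sub \<open>r \<noteq> 0\<close> by (intro card_mono poly_roots_finite)
    also have "\<dots> \<le> degree r" using \<open>r \<noteq> 0\<close> by (intro card_poly_roots_bound)
    also have "\<dots> \<le> n"
      unfolding r_def by (intro degree_diff_le deg order_trans[OF degree_smult_le dq])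
    finally show False by simp
  qed
  then have "p = smult (poly p 0) q" by (simp add: r_def)
  then have "poly p x = poly p 0 * poly q x" by (metis poly_smult)
  then show ?thesis by (simp add: q)
qed

text \<open>A polynomial of degree at most \<open>n\<close> with alternating signs at \<open>n + 1\<close> points has by the
  intermediate value theorem all its roots real and separated by these points.\<close>

lemma alternating_roots:
  fixes p :: "real poly"
  assumes deg: "degree p \<le> n" and t0: "0 \<le> t 0"
    and mono: "\<And>i j. i < j \<Longrightarrow> j \<le> n \<Longrightarrow> t i < t j"
    and alt: "\<And>k. k \<le> n \<Longrightarrow> 0 < (-1) ^ k * poly p (t k)"
  obtains \<rho> where "\<And>k. k < n \<Longrightarrow> t k < \<rho> k \<and> \<rho> k < t (Suc k)"
    "\<And>i j. i < j \<Longrightarrow> j < n \<Longrightarrow> \<rho> i < \<rho> j"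
    "\<And>x. poly p x = poly p 0 * (\<Prod>j<n. 1 - x / \<rho> j)"
proof -
  have "\<exists>r. k < n \<longrightarrow> t k < r \<and> r < t (Suc k) \<and> poly p r = 0" for k
  proof (cases "k < n")
    case True
    have lt: "t k < t (Suc k)" using mono True by auto
    have "0 < (-1) ^ k * poly p (t k)" "0 < (-1) ^ Suc k * poly p (t (Suc k))"
      using alt True by (auto simp del: power_Suc)
    then have "poly p (t k) * poly p (t (Suc k)) < 0"
      by (cases "even k") (auto simp: mult_pos_neg mult_neg_pos)
    then show ?thesis using poly_IVT[OF lt] by blast
  qed auto
  then obtain \<rho> where \<rho>: "\<And>k. k < n \<Longrightarrow> t k < \<rho> k \<and> \<rho> k < t (Suc k) \<and> poly p (\<rho> k) = 0"
    by metis
  have lt: "\<rho> i < \<rho> j" if "i < j" "j < n" for i j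
  proof -
    have "t (Suc i) \<le> t j"
    proof (cases "Suc i = j")
      case False
      then show ?thesis using that mono[of "Suc i" j] by auto
    qed auto
    then show ?thesis using \<rho>[of i] \<rho>[of j] that by auto
  qed
  have pos: "0 < \<rho> k" if "k < n" for k
  proof -
    have "t 0 \<le> t k" using mono[of 0 k] that by (cases k) auto
    then show ?thesis using \<rho>[OF that] t0 by auto
  qed
  have inj: "inj_on \<rho> {..<n}"
    by (rule linorder_inj_onI) (use lt in fastforce)+
  have "poly p x = poly p 0 * (\<Prod>j<n. 1 - x / \<rho> j)" for x
    by (rule poly_eq_prod_roots[OF deg inj]) (use \<rho> pos in fastforce)+
  then show thesis using \<rho> lt that by blast
qed

lemma sign_prod_between:
  fixes r :: "nat \<Rightarrow> real"
  assumes "k \<le> n" "\<And>i. i < k \<Longrightarrow> 0 < r i \<and> r i < x" "\<And>i. k \<le> i \<Longrightarrow> i < n \<Longrightarrow> 0 < r i \<and> x < r i"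
  shows "0 < (-1) ^ k * (\<Prod>i<n. 1 - x / r i)"
proof -
  have "(\<Prod>i<n. 1 - x / r i) = (\<Prod>i<k. 1 - x / r i) * (\<Prod>i=k..<n. 1 - x / r i)"
    using prod.atLeastLessThan_concat[of 0 k n "\<lambda>i. 1 - x / r i"] assms(1)
    by (simp add: atLeast0LessThan)
  moreover have "(-1) ^ k * (\<Prod>i<k. 1 - x / r i) = (\<Prod>i<k. x / r i - 1)"
    using prod.distrib[of "\<lambda>_. - 1" "\<lambda>i. 1 - x / r i" "{..<k}"] by simp
  moreover have "0 < (\<Prod>i<k. x / r i - 1)" "0 < (\<Prod>i=k..<n. 1 - x / r i)"
    using assms by (auto intro!: prod_pos simp: field_simps)
  ultimately show ?thesis by (metis mult.assoc mult_pos_pos)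
qed

section \<open>The shooting solution\<close>

text \<open>Polynomials in the spectral parameter: the solution of the eigenvalue recurrence with value
  \<open>0\<close> at the state \<open>0\<close> and unit flux through the first edge, and its flux from \<open>x\<close> to \<open>x + 1\<close>.
  As the solution vanishes at \<open>0\<close>, the flux first changes at the state \<open>1\<close>.\<close>

fun sol flux :: "(nat \<Rightarrow> real) \<Rightarrow> (nat \<Rightarrow> real) \<Rightarrow> nat \<Rightarrow> real poly" where
  "sol a m 0 = 0"
| "sol a m (Suc x) = sol a m x + smult (1 / a x) (flux a m x)"
| "flux a m 0 = 1"
| "flux a m (Suc x) =
     flux a m x - smult (m (Suc x)) (pCons 0 (sol a m x + smult (1 / a x) (flux a m x)))"

text \<open>\<open>a z\<close> is the conductance of the edge between \<open>z\<close> and \<open>z + 1\<close>. The two summability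
  assumptions say that infinity is an entrance boundary.\<close>

locale entrance_chain =
  fixes a m :: "nat \<Rightarrow> real"
  assumes a_pos: "a z > 0" and m_pos: "m x > 0"
    and not_summable_resistance: "\<not> summable (\<lambda>z. 1 / a z)"
    and summable_mass_scale: "summable (\<lambda>x. m x * (\<Sum>z<x. 1 / a z))"
begin

definition s :: "nat \<Rightarrow> real" where "s x = (\<Sum>z<x. 1 / a z)"

definition v :: "real \<Rightarrow> nat \<Rightarrow> real" where "v l x = poly (sol a m x) l"

definition F :: "real \<Rightarrow> nat \<Rightarrow> real" where "F l x = poly (flux a m x) l"

definition total :: real where "total = (\<Sum>x. m x * s x)"

text \<open>The characteristic function: its zeros will turn out to be the eigenvalues.\<close>

definition flux_limit :: "real \<Rightarrow> real" where "flux_limit l = 1 - l * (\<Sum>x. m x * v l x)"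

lemma v_0 [simp]: "v l 0 = 0" and F_0 [simp]: "F l 0 = 1"
  by (simp_all add: v_def F_def)

lemma v_Suc: "v l (Suc x) = v l x + F l x / a x"
  by (simp add: v_def F_def)

lemma F_Suc: "F l (Suc x) = F l x - l * m (Suc x) * v l (Suc x)"
  by (simp add: v_def F_def algebra_simps)

lemma s_0 [simp]: "s 0 = 0" and s_Suc: "s (Suc x) = s x + 1 / a x"
  by (simp_all add: s_def)

lemma s_nonneg: "0 \<le> s x"
  unfolding s_def by (intro sum_nonneg) (simp add: a_pos less_imp_le)

lemma s_strict_mono: "strict_mono s"
  using a_pos by (auto simp: strict_mono_Suc_iff s_Suc)

lemma s_mono: "x \<le> y \<Longrightarrow> s x \<le> s y"
  using s_strict_mono by (simp add: strict_mono_less_eq)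

lemma s_pos: "0 < x \<Longrightarrow> 0 < s x"
  using strict_monoD[OF s_strict_mono, of 0 x] by simp

lemma m_nonneg: "0 \<le> m x"
  using m_pos[of x] by simp

lemma s_at_top: "filterlim s at_top sequentially"
proof -
  have "incseq s" using s_mono by (auto simp: mono_def)
  moreover have "\<not> bdd_above (range s)"
  proof
    assume "bdd_above (range s)"
    then obtain B where B: "\<And>x. s x \<le> B" by (auto simp: bdd_above_def)
    have "(\<Sum>k\<le>n. 1 / a k) \<le> B" for n
      using B[of "Suc n"] by (simp add: s_def lessThan_Suc_atMost)
    then have "summable (\<lambda>z. 1 / a z)"
      by (intro bounded_imp_summable[of _ B]) (simp_all add: a_pos less_imp_le)
    then show False using not_summable_resistance by simp
  qed
  ultimately show ?thesis
    unfolding filterlim_at_top eventually_sequentially bdd_above_def incseq_def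
    by (metis rangeE linorder_le_cases order_trans)
qed

lemma summable_ms: "summable (\<lambda>x. m x * s x)"
  using summable_mass_scale by (simp add: s_def)

lemma sum_ms_le_total: "finite A \<Longrightarrow> (\<Sum>x\<in>A. m x * s x) \<le> total"
  unfolding total_def using summable_ms m_nonneg s_nonneg by (intro sum_le_suminf) auto

lemma total_nonneg: "0 \<le> total"
  using sum_ms_le_total[of "{}"] by simp

lemma summable_m: "summable m"
proof -
  have "norm (m (Suc x)) \<le> (m (Suc x) * s (Suc x)) / s 1" for x
    using mult_left_mono[OF s_mono[of 1 "Suc x"] m_nonneg[of "Suc x"]] m_nonneg[of "Suc x"] s_pos[of 1]
    by (simp add: field_simps)
  moreover have "summable (\<lambda>x. m (Suc x) * s (Suc x) / s 1)"
    using summable_ms summable_Suc_iff[of "\<lambda>x. m x * s x"] by (intro summable_divide) simp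
  ultimately have "summable (\<lambda>x. m (Suc x))" by (rule summable_comparison_test'[rotated])
  then show ?thesis using summable_Suc_iff[of m] by simp
qed

lemma growth_aux:
  "\<bar>F l x\<bar> \<le> exp (\<bar>l\<bar> * (\<Sum>y\<le>x. m y * s y)) \<and> \<bar>v l x\<bar> \<le> s x * exp (\<bar>l\<bar> * (\<Sum>y\<le>x. m y * s y))"
proof (induction x)
  case (Suc x)
  define G where "G = exp (\<bar>l\<bar> * (\<Sum>y\<le>x. m y * s y))"
  have G: "\<bar>F l x\<bar> \<le> G" "\<bar>v l x\<bar> \<le> s x * G" "0 < G" using Suc by (auto simp: G_def)
  have "\<bar>v l (Suc x)\<bar> \<le> \<bar>v l x\<bar> + \<bar>F l x\<bar> / a x"
    unfolding v_Suc using a_pos[of x] by (metis abs_divide abs_of_pos abs_triangle_ineq)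
  also have "\<dots> \<le> s x * G + G / a x"
    using G a_pos[of x] by (intro add_mono divide_right_mono) auto
  finally have vG: "\<bar>v l (Suc x)\<bar> \<le> s (Suc x) * G" by (simp add: s_Suc algebra_simps)
  define t where "t = \<bar>l\<bar> * (m (Suc x) * s (Suc x))"
  have t: "0 \<le> t" using m_nonneg s_nonneg by (simp add: t_def)
  have "\<bar>F l (Suc x)\<bar> \<le> \<bar>F l x\<bar> + \<bar>l\<bar> * m (Suc x) * \<bar>v l (Suc x)\<bar>"
    unfolding F_Suc using m_nonneg[of "Suc x"]
    by (metis abs_mult abs_of_nonneg abs_triangle_ineq4)
  also have "\<dots> \<le> G + \<bar>l\<bar> * m (Suc x) * (s (Suc x) * G)"
    using G vG m_nonneg[of "Suc x"] by (intro add_mono mult_left_mono) auto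
  also have "\<dots> = G * (1 + t)" by (simp add: t_def algebra_simps)
  also have "\<dots> \<le> G * exp t" using G by (intro mult_left_mono) auto
  finally have 1: "\<bar>F l (Suc x)\<bar> \<le> G * exp t" .
  have "s (Suc x) * G \<le> s (Suc x) * (G * exp t)"
    using G t s_nonneg[of "Suc x"] by (intro mult_left_mono mult_right_le_one_le) auto
  moreover have "exp (\<bar>l\<bar> * (\<Sum>y\<le>Suc x. m y * s y)) = G * exp t"
    by (simp add: G_def t_def distrib_left exp_add)
  ultimately show ?case using 1 vG by simp
qed simp

lemma growth:
  shows F_bound: "\<bar>F l x\<bar> \<le> exp (\<bar>l\<bar> * total)"
    and v_bound: "\<bar>v l x\<bar> \<le> s x * exp (\<bar>l\<bar> * total)"
proof -
  have le: "exp (\<bar>l\<bar> * (\<Sum>y\<le>x. m y * s y)) \<le> exp (\<bar>l\<bar> * total)"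
    using sum_ms_le_total[of "{..x}"] by (simp add: mult_left_mono)
  show "\<bar>F l x\<bar> \<le> exp (\<bar>l\<bar> * total)" using growth_aux[of l x] le by linarith
  show "\<bar>v l x\<bar> \<le> s x * exp (\<bar>l\<bar> * total)"
    using growth_aux[of l x] mult_left_mono[OF le s_nonneg[of x]] by linarith
qed

lemma summable_mv: "summable (\<lambda>x. m x * v l x)"
proof (rule summable_comparison_test)
  show "summable (\<lambda>x. m x * s x * exp (\<bar>l\<bar> * total))" by (intro summable_mult2 summable_ms)
  show "\<exists>N. \<forall>n\<ge>N. norm (m n * v l n) \<le> m n * s n * exp (\<bar>l\<bar> * total)"
    using mult_left_mono[OF v_bound m_nonneg] m_nonneg by (auto simp: abs_mult mult.assoc)
qed

lemma F_eq_sum: "F l x = 1 - l * (\<Sum>y\<le>x. m y * v l y)"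
  by (induction x) (auto simp: F_Suc algebra_simps)

lemma F_tendsto: "F l \<longlonglongrightarrow> flux_limit l"
proof -
  have "(\<lambda>x. \<Sum>y\<le>x. m y * v l y) \<longlonglongrightarrow> (\<Sum>x. m x * v l x)"
    using summable_LIMSEQ'[OF summable_mv] by simp
  then show ?thesis unfolding flux_limit_def F_eq_sum[abs_def] by (intro tendsto_intros)
qed

lemma F_eq_tail: "F l x = flux_limit l + l * (\<Sum>y. m (y + Suc x) * v l (y + Suc x))"
  using suminf_split_initial_segment[OF summable_mv, of l "Suc x"]
  by (simp add: F_eq_sum flux_limit_def algebra_simps lessThan_Suc_atMost)

text \<open>As the resistances diverge, this is the Stolz-Cesaro theorem: \<^term>\<open>v l\<close> and the scale
  function \<^term>\<open>s\<close> have the increments \<open>F l x / a x\<close> and \<open>1 / a x\<close>.\<close>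

lemma v_over_s_tendsto: "(\<lambda>x. v l x / s x) \<longlonglongrightarrow> flux_limit l"
proof (rule LIMSEQ_I)
  fix e :: real assume e: "0 < e"
  define W where "W = flux_limit l"
  obtain N where N: "\<And>z. z \<ge> N \<Longrightarrow> \<bar>F l z - W\<bar> < e / 2"
    using LIMSEQ_D[OF F_tendsto, of "e / 2" l] e by (auto simp: W_def)
  define K where "K = \<bar>v l N - W * s N\<bar>"
  have le: "\<bar>v l x - W * s x\<bar> \<le> K + e / 2 * (s x - s N)" if "x \<ge> N" for x
    using that
  proof (induction x rule: dec_induct)
    case base
    then show ?case by (simp add: K_def)
  next
    case (step x)
    have "v l (Suc x) - W * s (Suc x) = (v l x - W * s x) + (F l x - W) / a x"
      by (simp add: v_Suc s_Suc diff_divide_distrib distrib_left)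
    then have "\<bar>v l (Suc x) - W * s (Suc x)\<bar> \<le> \<bar>v l x - W * s x\<bar> + \<bar>F l x - W\<bar> / a x"
      using a_pos[of x] by (metis abs_divide abs_of_pos abs_triangle_ineq)
    also have "\<dots> \<le> K + e / 2 * (s x - s N) + (e / 2) / a x"
      using step N[of x] a_pos[of x] by (intro add_mono divide_right_mono) auto
    finally show ?case by (simp add: s_Suc algebra_simps)
  qed
  obtain M where M: "\<And>x. x \<ge> M \<Longrightarrow> s x > 2 * K / e"
    using s_at_top by (auto simp: filterlim_at_top_dense eventually_sequentially)
  have "\<bar>v l x / s x - W\<bar> < e" if "x \<ge> max (Suc N) M" for x
  proof -
    have sp: "0 < s x" using that by (intro s_pos) auto
    have "\<bar>v l x - W * s x\<bar> \<le> K + e / 2 * (s x - s N)" using that by (intro le) auto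
    also have "\<dots> \<le> K + e / 2 * s x" using e s_nonneg[of N] by (simp add: algebra_simps)
    also have "\<dots> < e * s x" using M[of x] that e by (simp add: field_simps)
    finally have "\<bar>v l x - W * s x\<bar> / s x < e" using sp by (simp add: field_simps)
    moreover have "v l x / s x - W = (v l x - W * s x) / s x" using sp by (simp add: field_simps)
    ultimately show ?thesis using sp by simp
  qed
  then show "\<exists>no. \<forall>n\<ge>no. norm (v l n / s n - flux_limit l) < e"
    unfolding W_def real_norm_def by blast
qed

lemma F_ge_one: "l \<le> 0 \<Longrightarrow> 1 \<le> F l x \<and> 0 \<le> v l x"
proof (induction x)
  case (Suc x)
  then have "0 \<le> v l (Suc x)" using a_pos[of x] by (simp add: v_Suc)
  moreover have "l * m (Suc x) * v l (Suc x) \<le> 0"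
    using Suc.prems m_nonneg[of "Suc x"] calculation by (simp add: mult_nonpos_nonneg)
  ultimately show ?case using Suc by (simp add: F_Suc)
qed simp

text \<open>For \<open>l \<le> 0\<close> the flux never falls below its initial value.\<close>

lemma flux_limit_zero_pos:
  assumes "flux_limit l = 0"
  shows "0 < l"
proof (rule ccontr)
  assume "\<not> 0 < l"
  then have "1 \<le> flux_limit l"
    using F_ge_one by (intro LIMSEQ_le_const[OF F_tendsto]) auto
  then show False using assms by simp
qed

lemma lagrange:
  "v l x * F k x - v k x * F l x = (l - k) * (\<Sum>y\<le>x. m y * v l y * v k y)"
proof (induction x)
  case (Suc x)
  have "v l (Suc x) * F k (Suc x) - v k (Suc x) * F l (Suc x)
      = v l (Suc x) * F k x - v k (Suc x) * F l x + (l - k) * (m (Suc x) * v l (Suc x) * v k (Suc x))"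
    by (simp add: F_Suc algebra_simps)
  also have "v l (Suc x) * F k x - v k (Suc x) * F l x = v l x * F k x - v k x * F l x"
    using a_pos[of x] by (simp add: v_Suc field_simps)
  finally show ?case unfolding Suc.IH by (simp add: distrib_left)
qed simp

end

section \<open>Roots of the shooting polynomials\<close>

context entrance_chain
begin

lemma degree_sol_flux: "degree (sol a m (Suc x)) \<le> x \<and> degree (flux a m x) \<le> x"
proof (induction x)
  case (Suc x)
  have s1: "sol a m (Suc (Suc x)) = sol a m (Suc x) + smult (1 / a (Suc x)) (flux a m (Suc x))"
    and f1: "flux a m (Suc x) = flux a m x - smult (m (Suc x)) (pCons 0 (sol a m (Suc x)))"
    by simp_all
  have "degree (pCons 0 (sol a m (Suc x))) \<le> Suc x"
    using Suc by (simp add: degree_pCons_eq_if)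
  then have fl: "degree (flux a m (Suc x)) \<le> Suc x"
    unfolding f1 using Suc by (intro degree_diff_le order_trans[OF degree_smult_le]) auto
  then have "degree (sol a m (Suc (Suc x))) \<le> Suc x"
    unfolding s1 using Suc by (intro degree_add_le order_trans[OF degree_smult_le]) auto
  with fl show ?case by simp
qed simp

lemmas degree_sol = degree_sol_flux[THEN conjunct1]

lemma sign_lead_coeff: "0 < (-1) ^ x * coeff (flux a m x) x \<and> 0 < (-1) ^ x * coeff (sol a m (Suc x)) x"
proof -
  have fl: "0 < (-1) ^ x * coeff (flux a m x) x"
    and so: "coeff (sol a m (Suc x)) x = coeff (flux a m x) x / a x" for x
  proof -
    show so: "coeff (sol a m (Suc x)) x = coeff (flux a m x) x / a x" for x
    proof -
      have "coeff (sol a m x) x = 0"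
        using degree_sol by (cases x) (auto intro!: coeff_eq_0 le_less_trans[OF degree_sol] simp del: sol.simps(2))
      then show ?thesis by simp
    qed
    show "0 < (-1) ^ x * coeff (flux a m x) x"
    proof (induction x)
      case (Suc x)
      have "coeff (flux a m x) (Suc x) = 0"
        using degree_sol_flux[of x] by (intro coeff_eq_0) auto
      then have "coeff (flux a m (Suc x)) (Suc x) = - (m (Suc x) * coeff (sol a m (Suc x)) x)"
        by simp
      also have "\<dots> = - (m (Suc x) / a x * coeff (flux a m x) x)"
        unfolding so by simp
      finally have "(-1) ^ Suc x * coeff (flux a m (Suc x)) (Suc x)
          = (m (Suc x) / a x) * ((-1) ^ x * coeff (flux a m x) x)" by simp
      then show ?case using Suc a_pos[of x] m_pos[of "Suc x"] by (simp del: flux.simps)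
    qed simp
  qed
  have "(-1) ^ x * coeff (sol a m (Suc x)) x = ((-1) ^ x * coeff (flux a m x) x) / a x"
    unfolding so by simp
  then show ?thesis using fl[of x] a_pos[of x] by simp
qed


lemma sol_sign_eventually: "\<exists>t>B. 0 < (-1) ^ x * v t (Suc x)"
proof -
  define p where "p = smult ((-1) ^ x) (sol a m (Suc x))"
  have c: "0 < coeff p x" using sign_lead_coeff[of x] by (simp add: p_def)
  have "degree p \<le> x" using degree_sol by (simp add: p_def del: sol.simps)
  then have "degree p = x" using c by (metis le_antisym le_degree less_irrefl)
  then have "0 < lead_coeff p" using c by simp
  then obtain n where "\<And>y. y \<ge> n \<Longrightarrow> lead_coeff p \<le> poly p y"
    using poly_pinfty_gt_lc by blast
  then have "0 < poly p (max n (B + 1))" using \<open>0 < lead_coeff p\<close> by (meson less_le_trans max.cobounded1)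
  then show ?thesis by (intro exI[of _ "max n (B + 1)"]) (auto simp: p_def v_def simp del: sol.simps)
qed

lemma v_zero_arg: "v 0 x = s x"
proof -
  have "F 0 x = 1" for x by (simp add: F_eq_sum)
  then show ?thesis by (induction x) (auto simp: v_Suc s_Suc)
qed

text \<open>The last clause records the signs of the preceding polynomial at the roots; it is what
  lets the alternation of signs propagate from \<open>n\<close> to \<open>n + 1\<close>.\<close>

definition roots_of :: "nat \<Rightarrow> (nat \<Rightarrow> real) \<Rightarrow> bool" where
  "roots_of n r \<longleftrightarrow> (\<forall>j<n. 0 < r j) \<and> (\<forall>i j. i < j \<longrightarrow> j < n \<longrightarrow> r i < r j) \<and>
     (\<forall>l. v l (Suc n) = s (Suc n) * (\<Prod>j<n. 1 - l / r j)) \<and>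
     (\<forall>j<n. 0 < (-1) ^ j * v (r j) n)"

text \<open>The Sturm step. At a root of \<^term>\<open>\<lambda>l. v l (Suc n)\<close> the neighbouring values
  \<^term>\<open>v l n\<close> and \<^term>\<open>v l (Suc (Suc n))\<close> have opposite signs, by the three-term recurrence.\<close>

lemma sturm_step:
  assumes "roots_of n r"
  shows "\<exists>r'. roots_of (Suc n) r' \<and> (\<forall>j<n. r' j < r j \<and> r j < r' (Suc j))"
proof -
  have pos: "0 < r j" and sg: "0 < (-1) ^ j * v (r j) n" if "j < n" for j
    using assms that by (auto simp: roots_of_def)
  have lt: "r i < r j" if "i < j" "j < n" for i j
    using assms that by (auto simp: roots_of_def)
  have fac: "v l (Suc n) = s (Suc n) * (\<Prod>j<n. 1 - l / r j)" for l
    using assms by (auto simp: roots_of_def)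
  obtain top where top: "top > (if n = 0 then 0 else r (n - 1))"
    and top_sg: "0 < (-1) ^ Suc n * v top (Suc (Suc n))"
    using sol_sign_eventually by blast
  define t where "t k = (if k = 0 then 0 else if k \<le> n then r (k - 1) else top)" for k
  have t_Suc: "t (Suc j) = r j" if "j < n" for j using that by (simp add: t_def)
  have top_r: "r j < top" if "j < n" for j
    using top lt[of j "n - 1"] that by (cases "j = n - 1") fastforce+
  have top0: "0 < top" using top pos[of "n - 1"] by (auto split: if_splits)
  have "\<exists>\<rho>. (\<forall>k<Suc n. t k < \<rho> k \<and> \<rho> k < t (Suc k)) \<and> (\<forall>i j. i < j \<longrightarrow> j < Suc n \<longrightarrow> \<rho> i < \<rho> j) \<and>
      (\<forall>x. poly (sol a m (Suc (Suc n))) x = poly (sol a m (Suc (Suc n))) 0 * (\<Prod>j<Suc n. 1 - x / \<rho> j))"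
  proof (rule alternating_roots[of "sol a m (Suc (Suc n))" "Suc n" t])
    show "degree (sol a m (Suc (Suc n))) \<le> Suc n" by (rule degree_sol)
    show "0 \<le> t 0" by (simp add: t_def)
    show "t i < t j" if "i < j" "j \<le> Suc n" for i j
    proof -
      from \<open>i < j\<close> obtain j' where j': "j = Suc j'" by (cases j) auto
      show ?thesis
      proof (cases i)
        case 0
        then show ?thesis using j' pos[of j'] top0 that by (auto simp: t_def)
      next
        case (Suc i')
        then show ?thesis using j' lt[of i' j'] top_r[of i'] that by (auto simp: t_def)
      qed
    qed
    show "0 < (-1) ^ k * poly (sol a m (Suc (Suc n))) (t k)" if "k \<le> Suc n" for k
    proof -
      have "k = 0 \<or> (\<exists>j. k = Suc j \<and> j < n) \<or> k = Suc n" using that by (cases k) auto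
      then consider "k = 0" | j where "k = Suc j" "j < n" | "k = Suc n" by blast
      then show ?thesis
      proof cases
        case 1
        then show ?thesis
          using v_zero_arg[of "Suc (Suc n)"] s_pos[of "Suc (Suc n)"] by (simp add: t_def v_def del: sol.simps)
      next
        case 2
        have v0: "v (r j) (Suc n) = 0"
          unfolding fac using 2 pos[of j] by (auto intro!: prod_zero bexI[of _ j])
        have "v (r j) (Suc (Suc n)) = F (r j) n / a (Suc n)"
          by (simp add: v_Suc[of _ "Suc n"] F_Suc v0)
        moreover have "F (r j) n = - (a n * v (r j) n)"
          using v0 a_pos[of n] by (simp add: v_Suc field_simps)
        ultimately have "(-1) ^ k * v (r j) (Suc (Suc n)) = a n / a (Suc n) * ((-1) ^ j * v (r j) n)"
          by (simp add: 2)
        then show ?thesis using sg[of j] 2 a_pos[of n] a_pos[of "Suc n"]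
          by (simp add: t_Suc v_def del: sol.simps)
      next
        case 3
        then show ?thesis using top_sg by (simp add: t_def v_def del: sol.simps)
      qed
    qed
  qed blast
  then obtain \<rho> where between: "\<And>k. k < Suc n \<Longrightarrow> t k < \<rho> k \<and> \<rho> k < t (Suc k)"
    and mono: "\<And>i j. i < j \<Longrightarrow> j < Suc n \<Longrightarrow> \<rho> i < \<rho> j"
    and fac': "\<And>x. v x (Suc (Suc n)) = v 0 (Suc (Suc n)) * (\<Prod>j<Suc n. 1 - x / \<rho> j)"
    unfolding v_def by blast
  have inter: "\<rho> j < r j \<and> r j < \<rho> (Suc j)" if "j < n" for j
    using between[of j] between[of "Suc j"] that by (simp add: t_Suc)
  have pos': "0 < \<rho> j" if "j < Suc n" for j
    using between[of 0] mono[of 0 j] that by (cases j) (auto simp: t_def)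
  have "0 < (-1) ^ j * v (\<rho> j) (Suc n)" if j: "j < Suc n" for j
  proof -
    have "0 < (-1) ^ j * (\<Prod>i<n. 1 - \<rho> j / r i)"
    proof (rule sign_prod_between)
      show "j \<le> n" using j by simp
      show "0 < r i \<and> r i < \<rho> j" if "i < j" for i
        using inter[of i] mono[of "Suc i" j] pos[of i] that j by (cases "Suc i = j") auto
      show "0 < r i \<and> \<rho> j < r i" if "j \<le> i" "i < n" for i
        using inter[of i] mono[of j i] pos[of i] that by (cases "i = j") auto
    qed
    then show ?thesis unfolding fac using s_pos[of "Suc n"]
      by (metis mult.left_commute zero_less_Suc zero_less_mult_iff)
  qed
  then have "roots_of (Suc n) \<rho>"
    using pos' mono fac' by (auto simp: roots_of_def v_zero_arg)
  then show ?thesis using inter by blast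
qed

lemma interlacing_roots_exist:
  "\<exists>r. \<forall>n. roots_of n (r n) \<and> (\<forall>j<n. r (Suc n) j < r n j \<and> r n j < r (Suc n) (Suc j))"
proof -
  have "\<exists>r. roots_of 0 r" by (auto simp: roots_of_def v_Suc s_Suc)
  then have "\<exists>r. \<forall>n. roots_of n (r n) \<and> (\<forall>j<n. r (Suc n) j < r n j \<and> r n j < r (Suc n) (Suc j))"
    using dependent_nat_choice[of roots_of "\<lambda>n r r'. \<forall>j<n. r' j < r j \<and> r j < r' (Suc j)"] sturm_step
    by blast
  then show ?thesis .
qed

text \<open>The eigenvalues of the chain killed at \<open>n + 1\<close>, in increasing order. The choice is made for all
  \<open>n\<close> at once only to have the interlacing available; the roots themselves are unique.\<close>

definition trunc_ev :: "nat \<Rightarrow> nat \<Rightarrow> real" where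
  "trunc_ev = (SOME r. \<forall>n. roots_of n (r n) \<and> (\<forall>j<n. r (Suc n) j < r n j \<and> r n j < r (Suc n) (Suc j)))"

lemma trunc_ev_spec: "roots_of n (trunc_ev n) \<and> (\<forall>j<n. trunc_ev (Suc n) j < trunc_ev n j \<and> trunc_ev n j < trunc_ev (Suc n) (Suc j))"
  using someI_ex[OF interlacing_roots_exist] unfolding trunc_ev_def by blast

lemma trunc_ev_pos: "j < n \<Longrightarrow> 0 < trunc_ev n j"
  and trunc_ev_less: "i < j \<Longrightarrow> j < n \<Longrightarrow> trunc_ev n i < trunc_ev n j"
  and v_factor: "v l (Suc n) = s (Suc n) * (\<Prod>j<n. 1 - l / trunc_ev n j)"
  and trunc_ev_sign: "j < n \<Longrightarrow> 0 < (-1) ^ j * v (trunc_ev n j) n"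
  and trunc_ev_Suc_less: "j < n \<Longrightarrow> trunc_ev (Suc n) j < trunc_ev n j"
  using trunc_ev_spec[of n] by (auto simp: roots_of_def)

lemma trunc_ev_antimono:
  assumes "j < n" "n \<le> k"
  shows "trunc_ev k j \<le> trunc_ev n j"
  using assms(2)
proof (induction k rule: dec_induct)
  case (step k)
  then show ?case using trunc_ev_Suc_less[of j k] assms by auto
qed simp

definition bnd :: real where "bnd = exp total - 1"

text \<open>The reciprocals of the roots stay summable uniformly in the degree: evaluate the factorisation at
  \<open>-1\<close> and compare with the growth bound.\<close>

lemma sum_inverse_trunc_ev_le:
  assumes "J \<le> n"
  shows "(\<Sum>j<J. 1 / trunc_ev n j) \<le> bnd"
proof -
  have "(\<Sum>j<J. 1 / trunc_ev n j) \<le> (\<Sum>j<n. 1 / trunc_ev n j)"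
    using assms trunc_ev_pos by (intro sum_mono2) (auto intro!: less_imp_le)
  moreover have "1 + (\<Sum>j<n. 1 / trunc_ev n j) \<le> (\<Prod>j<n. 1 + 1 / trunc_ev n j)"
    using trunc_ev_pos by (intro sum_le_prod_one_plus) (auto intro!: less_imp_le)
  moreover have "(\<Prod>j<n. 1 + 1 / trunc_ev n j) \<le> exp total"
    using v_bound[of "-1" "Suc n"] s_pos[of "Suc n"] v_factor[of "-1" n] by (simp add: abs_le_iff)
  ultimately show ?thesis by (simp add: bnd_def)
qed

lemma bnd_nonneg: "0 \<le> bnd"
  using total_nonneg by (simp add: bnd_def)

lemma trunc_ev_lower:
  assumes "j < n"
  shows "1 / (bnd + 1) \<le> trunc_ev n j"
proof -
  have "1 / trunc_ev n j \<le> (\<Sum>i<n. 1 / trunc_ev n i)"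
    using assms trunc_ev_pos by (intro member_le_sum) (auto intro!: less_imp_le)
  then have "1 / trunc_ev n j \<le> bnd + 1" using sum_inverse_trunc_ev_le[of n n] by simp
  then show ?thesis using trunc_ev_pos[OF assms] bnd_nonneg by (simp add: field_simps)
qed

end

section \<open>Limits of the truncated eigenvalues\<close>

context entrance_chain
begin

definition ev :: "nat \<Rightarrow> real" where "ev j = lim (\<lambda>n. trunc_ev (n + Suc j) j)"

lemma trunc_ev_tendsto: "(\<lambda>n. trunc_ev n j) \<longlonglongrightarrow> ev j"
proof -
  have "decseq (\<lambda>n. trunc_ev (n + Suc j) j)"
    by (auto simp: decseq_def intro!: trunc_ev_antimono)
  moreover have "1 / (bnd + 1) \<le> trunc_ev (n + Suc j) j" for n
    by (rule trunc_ev_lower) simp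
  ultimately obtain L where "(\<lambda>n. trunc_ev (n + Suc j) j) \<longlonglongrightarrow> L"
    using decseq_convergent by blast
  then have "convergent (\<lambda>n. trunc_ev (n + Suc j) j)" by (rule convergentI)
  then have "(\<lambda>n. trunc_ev (n + Suc j) j) \<longlonglongrightarrow> ev j"
    by (simp add: ev_def convergent_LIMSEQ_iff)
  then show ?thesis by (rule LIMSEQ_offset)
qed

lemma ev_pos: "0 < ev j"
proof -
  have "1 / (bnd + 1) \<le> ev j"
    using trunc_ev_lower by (intro LIMSEQ_le_const[OF trunc_ev_tendsto]) (auto intro!: exI[of _ "Suc j"])
  then show ?thesis using bnd_nonneg by (smt (verit) divide_pos_pos)
qed

lemma ev_less_trunc_ev:
  assumes "j < n"
  shows "ev j < trunc_ev n j"
proof -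
  have "ev j \<le> trunc_ev (Suc n) j"
    using trunc_ev_antimono assms
    by (intro LIMSEQ_le_const2[OF trunc_ev_tendsto]) (auto intro!: exI[of _ "Suc n"])
  then show ?thesis using trunc_ev_Suc_less[OF assms] by simp
qed

lemma ev_le_ev_Suc: "ev j \<le> ev (Suc j)"
  using trunc_ev_less
  by (intro LIMSEQ_le[OF trunc_ev_tendsto trunc_ev_tendsto]) (auto intro!: exI[of _ "Suc (Suc j)"] less_imp_le)

lemma sum_inverse_ev_le: "(\<Sum>j<J. 1 / ev j) \<le> bnd"
proof (rule LIMSEQ_le_const2)
  show "(\<lambda>n. \<Sum>j<J. 1 / trunc_ev n j) \<longlonglongrightarrow> (\<Sum>j<J. 1 / ev j)"
    using ev_pos by (intro tendsto_intros trunc_ev_tendsto) (auto simp: less_le)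
  show "\<exists>N. \<forall>n\<ge>N. (\<Sum>j<J. 1 / trunc_ev n j) \<le> bnd"
    using sum_inverse_trunc_ev_le by blast
qed

lemma summable_inverse_ev: "summable (\<lambda>j. 1 / ev j)"
proof (rule bounded_imp_summable)
  show "0 \<le> 1 / ev j" for j using ev_pos[of j] by simp
  show "(\<Sum>j\<le>n. 1 / ev j) \<le> bnd" for n using sum_inverse_ev_le[of "Suc n"] by (simp only: lessThan_Suc_atMost)
qed

lemma prod_trunc_tendsto: "(\<lambda>n. \<Prod>j<n. 1 - l / trunc_ev n j) \<longlonglongrightarrow> flux_limit l"
proof -
  have "v l (Suc n) / s (Suc n) = (\<Prod>j<n. 1 - l / trunc_ev n j)" for n
    using v_factor[of l n] s_pos[of "Suc n"] by simp
  then show ?thesis using LIMSEQ_Suc[OF v_over_s_tendsto, of l] by simp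
qed

text \<open>The value at \<open>l\<close> of the entire function \<^term>\<open>flux_limit\<close> is controlled by any finitely many
  of its zeros; two equal limits of roots would thus make a double zero.\<close>

lemma flux_limit_bound:
  "\<bar>flux_limit l\<bar> \<le> (\<Prod>j\<in>{k..<k'}. \<bar>1 - l / ev j\<bar>) * exp (\<bar>l\<bar> * bnd)"
proof (rule LIMSEQ_le)
  show "(\<lambda>n. \<bar>\<Prod>j<n. 1 - l / trunc_ev n j\<bar>) \<longlonglongrightarrow> \<bar>flux_limit l\<bar>"
    by (intro tendsto_rabs prod_trunc_tendsto)
  show "(\<lambda>n. (\<Prod>j\<in>{k..<k'}. \<bar>1 - l / trunc_ev n j\<bar>) * exp (\<bar>l\<bar> * bnd))
      \<longlonglongrightarrow> (\<Prod>j\<in>{k..<k'}. \<bar>1 - l / ev j\<bar>) * exp (\<bar>l\<bar> * bnd)"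
    using ev_pos by (intro tendsto_intros trunc_ev_tendsto) (auto simp: less_le)
  have "\<bar>\<Prod>j<n. 1 - l / trunc_ev n j\<bar> \<le> (\<Prod>j\<in>{k..<k'}. \<bar>1 - l / trunc_ev n j\<bar>) * exp (\<bar>l\<bar> * bnd)"
    if "n \<ge> k'" for n
  proof -
    let ?A = "{..<n} - {k..<k'}"
    have pos: "0 < trunc_ev n j" if "j < n" for j using that trunc_ev_pos by simp
    have "(\<Prod>j\<in>?A. \<bar>1 - l / trunc_ev n j\<bar>) \<le> (\<Prod>j\<in>?A. 1 + \<bar>l\<bar> / trunc_ev n j)"
    proof (rule prod_mono)
      fix j assume "j \<in> ?A"
      then have "\<bar>l / trunc_ev n j\<bar> = \<bar>l\<bar> / trunc_ev n j" using pos[of j] by (simp add: abs_divide)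
      then show "0 \<le> \<bar>1 - l / trunc_ev n j\<bar> \<and> \<bar>1 - l / trunc_ev n j\<bar> \<le> 1 + \<bar>l\<bar> / trunc_ev n j"
        by linarith
    qed
    also have "\<dots> \<le> exp (\<Sum>j\<in>?A. \<bar>l\<bar> / trunc_ev n j)"
      using pos by (intro prod_one_plus_le_exp) (auto intro!: divide_nonneg_pos)
    also have "\<dots> \<le> exp (\<bar>l\<bar> * bnd)"
    proof -
      have "(\<Sum>j\<in>?A. \<bar>l\<bar> / trunc_ev n j) \<le> (\<Sum>j<n. \<bar>l\<bar> / trunc_ev n j)"
        using pos by (intro sum_mono2) (auto intro!: divide_nonneg_pos)
      also have "\<dots> = \<bar>l\<bar> * (\<Sum>j<n. 1 / trunc_ev n j)"
        by (simp add: sum_distrib_left)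
      also have "\<dots> \<le> \<bar>l\<bar> * bnd"
        by (intro mult_left_mono sum_inverse_trunc_ev_le) auto
      finally show ?thesis by simp
    qed
    finally have rest: "(\<Prod>j\<in>?A. \<bar>1 - l / trunc_ev n j\<bar>) \<le> exp (\<bar>l\<bar> * bnd)" .
    have "\<bar>\<Prod>j<n. 1 - l / trunc_ev n j\<bar> = (\<Prod>j<n. \<bar>1 - l / trunc_ev n j\<bar>)"
      by (simp add: abs_prod)
    also have "\<dots> = (\<Prod>j\<in>?A. \<bar>1 - l / trunc_ev n j\<bar>) * (\<Prod>j\<in>{k..<k'}. \<bar>1 - l / trunc_ev n j\<bar>)"
      using that by (intro prod.subset_diff) auto
    also have "\<dots> \<le> exp (\<bar>l\<bar> * bnd) * (\<Prod>j\<in>{k..<k'}. \<bar>1 - l / trunc_ev n j\<bar>)"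
      by (intro mult_right_mono rest prod_nonneg) auto
    finally show ?thesis by (simp only: mult.commute)
  qed
  then show "\<exists>N. \<forall>n\<ge>N. \<bar>\<Prod>j<n. 1 - l / trunc_ev n j\<bar>
      \<le> (\<Prod>j\<in>{k..<k'}. \<bar>1 - l / trunc_ev n j\<bar>) * exp (\<bar>l\<bar> * bnd)" by blast
qed

lemma flux_limit_ev: "flux_limit (ev k) = 0"
  using flux_limit_bound[of "ev k" k "Suc k"] ev_pos[of k] by simp

text \<open>Away from the limits of the roots the factorised polynomials stay away from zero: finitely many
  factors converge to nonzero limits, and the product of all others is at least \<open>1 / 2\<close> because
  their reciprocal roots sum to little.\<close>

lemma flux_limit_zero_is_ev:
  assumes "flux_limit l = 0"
  shows "\<exists>k. l = ev k"
proof (rule ccontr)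
  assume no: "\<not> (\<exists>k. l = ev k)"
  have l: "0 < l" using flux_limit_zero_pos[OF assms] .
  obtain J where J: "\<And>n. n \<ge> J \<Longrightarrow> norm (\<Sum>i. 1 / ev (i + n)) < 1 / (2 * l)"
    using suminf_exist_split[OF _ summable_inverse_ev, of "1 / (2 * l)"] l by auto
  have tail: "(\<Sum>j\<in>{J..<n}. l / ev j) \<le> 1 / 2" for n
  proof -
    have "(\<Sum>j\<in>{J..<n}. 1 / ev j) = (\<Sum>i<n - J. 1 / ev (i + J))"
      by (rule sum.reindex_bij_witness[of _ "\<lambda>i. i + J" "\<lambda>j. j - J"]) auto
    also have "\<dots> \<le> (\<Sum>i. 1 / ev (i + J))"
      using ev_pos summable_ignore_initial_segment[OF summable_inverse_ev]
      by (intro sum_le_suminf) (auto intro!: less_imp_le)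
    also have "\<dots> \<le> 1 / (2 * l)" using J[of J] by simp
    finally have "l * (\<Sum>j\<in>{J..<n}. 1 / ev j) \<le> l * (1 / (2 * l))" using l by (intro mult_left_mono) auto
    then show ?thesis using l by (simp add: sum_distrib_left)
  qed
  have "(\<Prod>j<J. \<bar>1 - l / ev j\<bar>) / 2 \<le> \<bar>flux_limit l\<bar>"
  proof (rule LIMSEQ_le)
    show "(\<lambda>n. \<bar>\<Prod>j<n. 1 - l / trunc_ev n j\<bar>) \<longlonglongrightarrow> \<bar>flux_limit l\<bar>"
      by (intro tendsto_rabs prod_trunc_tendsto)
    show "(\<lambda>n. (\<Prod>j<J. \<bar>1 - l / trunc_ev n j\<bar>) / 2) \<longlonglongrightarrow> (\<Prod>j<J. \<bar>1 - l / ev j\<bar>) / 2"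
      using ev_pos by (intro tendsto_intros trunc_ev_tendsto) (auto simp: less_le)
    have "(\<Prod>j<J. \<bar>1 - l / trunc_ev n j\<bar>) / 2 \<le> \<bar>\<Prod>j<n. 1 - l / trunc_ev n j\<bar>" if "n \<ge> J" for n
    proof -
      have le: "l / trunc_ev n j \<le> l / ev j" if "j < n" for j
        using ev_less_trunc_ev[OF that] ev_pos[of j] l by (intro divide_left_mono) auto
      have sum: "(\<Sum>j\<in>{J..<n}. l / trunc_ev n j) \<le> 1 / 2"
        using le by (intro order_trans[OF sum_mono tail[of n]]) auto
      have nn: "0 \<le> l / trunc_ev n j" if "j < n" for j using trunc_ev_pos[OF that] l by simp
      have "l / trunc_ev n j \<le> 1" if "j \<in> {J..<n}" for j
        using member_le_sum[of j "{J..<n}" "\<lambda>j. l / trunc_ev n j"] nn sum that by auto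
      then have "1 - (\<Sum>j\<in>{J..<n}. l / trunc_ev n j) \<le> (\<Prod>j\<in>{J..<n}. 1 - l / trunc_ev n j)"
        using nn by (intro prod_one_minus_ge) auto
      then have half: "1 / 2 \<le> (\<Prod>j\<in>{J..<n}. 1 - l / trunc_ev n j)" using sum by linarith
      have "(\<Prod>j<n. 1 - l / trunc_ev n j)
          = (\<Prod>j<J. 1 - l / trunc_ev n j) * (\<Prod>j\<in>{J..<n}. 1 - l / trunc_ev n j)"
        using prod.atLeastLessThan_concat[of 0 J n "\<lambda>j. 1 - l / trunc_ev n j"] that
        by (simp add: atLeast0LessThan)
      then have "\<bar>\<Prod>j<n. 1 - l / trunc_ev n j\<bar>
          = (\<Prod>j<J. \<bar>1 - l / trunc_ev n j\<bar>) * (\<Prod>j\<in>{J..<n}. 1 - l / trunc_ev n j)"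
        using half by (simp add: abs_mult abs_prod[of _ "{..<J}"])
      moreover have "(\<Prod>j<J. \<bar>1 - l / trunc_ev n j\<bar>) * (1 / 2)
          \<le> (\<Prod>j<J. \<bar>1 - l / trunc_ev n j\<bar>) * (\<Prod>j\<in>{J..<n}. 1 - l / trunc_ev n j)"
        by (intro mult_left_mono half prod_nonneg) auto
      ultimately show ?thesis by simp
    qed
    then show "\<exists>N. \<forall>n\<ge>N. (\<Prod>j<J. \<bar>1 - l / trunc_ev n j\<bar>) / 2 \<le> \<bar>\<Prod>j<n. 1 - l / trunc_ev n j\<bar>"
      by blast
  qed
  moreover have "1 - l / ev j \<noteq> 0" for j
    using no ev_pos[of j] by (auto simp: field_simps)
  then have "0 < (\<Prod>j<J. \<bar>1 - l / ev j\<bar>)" by (intro prod_pos) auto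
  ultimately show False using assms by simp
qed

text \<open>All roots of all shooting polynomials lie above \<^term>\<open>ev 0\<close>.\<close>

lemma v_pos:
  assumes "l \<le> ev 0"
  shows "0 < v l (Suc n)"
proof -
  have "0 < 1 - l / trunc_ev n j" if "j < n" for j
  proof -
    have "trunc_ev n 0 \<le> trunc_ev n j" using that trunc_ev_less[of 0 j n] by (cases j) auto
    then have "l < trunc_ev n j" using ev_less_trunc_ev[of 0 n] assms that by simp
    then show ?thesis using trunc_ev_pos[OF that] by (simp add: field_simps)
  qed
  then show ?thesis unfolding v_factor using s_pos[of "Suc n"] by (intro mult_pos_pos prod_pos) auto
qed

section \<open>Eigenfunctions are bounded\<close>

lemma summable_ms_abs_min: "summable (\<lambda>y. m y * min (s x) (s y) * \<bar>v l y\<bar>)"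
proof (rule summable_comparison_test')
  show "summable (\<lambda>y. s x * exp (\<bar>l\<bar> * total) * (m y * s y))"
    by (intro summable_mult summable_ms)
  show "norm (m y * min (s x) (s y) * \<bar>v l y\<bar>) \<le> s x * exp (\<bar>l\<bar> * total) * (m y * s y)" if "y \<ge> 0" for y
  proof -
    have "norm (m y * min (s x) (s y) * \<bar>v l y\<bar>) = m y * (min (s x) (s y) * \<bar>v l y\<bar>)"
      using m_nonneg s_nonneg by (simp add: abs_mult min_def)
    also have "\<dots> \<le> m y * (s x * (s y * exp (\<bar>l\<bar> * total)))"
      using m_nonneg s_nonneg by (intro mult_left_mono mult_mono v_bound) auto
    finally show ?thesis by (simp add: algebra_simps)
  qed
qed

text \<open>Without flux at infinity the solution is a fixed point of \<open>l\<close> times the Green operator.\<close>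

lemma v_green:
  assumes "flux_limit l = 0"
  shows "v l x = l * (\<Sum>y. m y * min (s x) (s y) * v l y)"
proof -
  let ?g = "\<lambda>y. m y * min (s x) (s y) * v l y"
  have "norm (?g y) = m y * min (s x) (s y) * \<bar>v l y\<bar>" for y
    using m_nonneg s_nonneg by (simp add: abs_mult min_def)
  then have "summable (\<lambda>y. norm (?g y))"
    using summable_ms_abs_min[of x l] by (simp only:)
  then have sg: "summable ?g" by (rule summable_norm_cancel)
  have parts: "v l x - s x * F l x = l * (\<Sum>y<Suc x. m y * s y * v l y)"
  proof (induction x)
    case (Suc x)
    have "v l (Suc x) - s (Suc x) * F l (Suc x)
        = (v l x - s x * F l x) + l * (m (Suc x) * s (Suc x) * v l (Suc x))"
      using a_pos[of x] by (simp add: F_Suc v_Suc s_Suc field_simps)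
    then show ?case unfolding Suc.IH by (simp add: distrib_left)
  qed simp
  have "(\<Sum>y. ?g y) = (\<Sum>y. ?g (y + Suc x)) + (\<Sum>y<Suc x. ?g y)"
    by (rule suminf_split_initial_segment[OF sg])
  also have "(\<Sum>y<Suc x. ?g y) = (\<Sum>y<Suc x. m y * s y * v l y)"
    by (intro sum.cong refl) (simp add: min_absorb2 s_mono)
  also have "(\<lambda>y. ?g (y + Suc x)) = (\<lambda>y. s x * (m (y + Suc x) * v l (y + Suc x)))"
    by (intro ext) (simp add: min_absorb1 s_mono)
  also have "(\<Sum>y. s x * (m (y + Suc x) * v l (y + Suc x))) = s x * (\<Sum>y. m (y + Suc x) * v l (y + Suc x))"
    using summable_ignore_initial_segment[OF summable_mv] by (intro suminf_mult)
  finally have "l * (\<Sum>y. ?g y) = s x * (l * (\<Sum>y. m (y + Suc x) * v l (y + Suc x)))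
      + l * (\<Sum>y<Suc x. m y * s y * v l y)" by (simp only: distrib_left mult.left_commute)
  also have "l * (\<Sum>y. m (y + Suc x) * v l (y + Suc x)) = F l x"
    using F_eq_tail[of l x] assms by simp
  finally have "l * (\<Sum>y. ?g y) = s x * F l x + (v l x - s x * F l x)"
    unfolding parts .
  then show ?thesis by simp
qed

text \<open>Far out, the Green operator with kernel \<open>min (s x) (s y)\<close> halves the weighted sup norm with
  weight \<open>1 + e * s\<close>, uniformly in \<open>e > 0\<close>; this norm is finite by the growth bound, and
  letting \<open>e\<close> tend to \<open>0\<close> gives the sup norm.\<close>

lemma v_bounded:
  assumes W: "flux_limit l = 0"
  obtains B where "\<And>x. \<bar>v l x\<bar> \<le> B"
proof -
  have l: "0 < l" using flux_limit_zero_pos[OF W] .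
  obtain N where N: "norm (\<Sum>i. m (i + N) * s (i + N)) < 1 / (2 * l)"
    using suminf_exist_split[OF _ summable_ms, of "1 / (2 * l)"] l by auto
  define K where "K = l * (\<Sum>y<N. m y * s y * \<bar>v l y\<bar>)"
  have weighted: "\<bar>v l x\<bar> \<le> 2 * K * (1 + e * s x)" if e: "0 < e" for e x
  proof -
    define w where "w x = 1 + e * s x" for x
    have w: "0 < w x" "1 \<le> w x" for x using e s_nonneg[of x] by (auto simp: w_def add_pos_nonneg)
    define c where "c = (SUP x. \<bar>v l x\<bar> / w x)"
    have bdd: "bdd_above (range (\<lambda>x. \<bar>v l x\<bar> / w x))"
    proof (rule bdd_aboveI2)
      fix x
      have "\<bar>v l x\<bar> \<le> s x * exp (\<bar>l\<bar> * total)" by (rule v_bound)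
      also have "\<dots> \<le> w x / e * exp (\<bar>l\<bar> * total)"
        using e s_nonneg[of x] by (intro mult_right_mono) (auto simp: w_def field_simps)
      finally show "\<bar>v l x\<bar> / w x \<le> exp (\<bar>l\<bar> * total) / e" using w[of x] e by (simp add: field_simps)
    qed
    have c: "\<bar>v l x\<bar> \<le> c * w x" for x
      using cSUP_upper[OF UNIV_I bdd, of x] w[of x] by (simp add: c_def field_simps)
    have c0: "0 \<le> c" using c[of 0] w[of 0] by (simp add: zero_le_mult_iff)
    have "\<bar>v l x\<bar> / w x \<le> K + c / 2" for x
    proof -
      let ?g = "\<lambda>y. m y * min (s x) (s y) * \<bar>v l y\<bar>"
      note sg = summable_ms_abs_min[of x l]
      have "\<bar>v l x\<bar> = l * \<bar>\<Sum>y. m y * min (s x) (s y) * v l y\<bar>"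
        using v_green[OF W, of x] l by (metis abs_mult abs_of_pos)
      also have "\<bar>\<Sum>y. m y * min (s x) (s y) * v l y\<bar> \<le> (\<Sum>y. ?g y)"
      proof -
        have "norm (m y * min (s x) (s y) * v l y) = ?g y" for y
          using m_nonneg s_nonneg by (simp add: abs_mult min_def)
        then show ?thesis
          using summable_norm[of "\<lambda>y. m y * min (s x) (s y) * v l y"] sg by simp
      qed
      also have "(\<Sum>y. ?g y) = (\<Sum>i. ?g (i + N)) + (\<Sum>y<N. ?g y)"
        by (rule suminf_split_initial_segment[OF sg])
      also have "(\<Sum>y<N. ?g y) \<le> (\<Sum>y<N. m y * s y * \<bar>v l y\<bar>)"
        using m_nonneg by (intro sum_mono mult_right_mono mult_left_mono) auto
      also have "(\<Sum>i. ?g (i + N)) \<le> (\<Sum>i. c * w x * (m (i + N) * s (i + N)))"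
      proof (rule suminf_le)
        fix i
        let ?y = "i + N"
        have "min (s x) (s ?y) * w ?y \<le> s ?y * w x"
        proof (cases "s x \<le> s ?y")
          case True
          then show ?thesis by (simp add: w_def min_def algebra_simps)
        next
          case False
          then show ?thesis using e s_nonneg[of ?y]
            by (auto simp: w_def min_def intro!: mult_left_mono add_left_mono)
        qed
        then have "min (s x) (s ?y) * (c * w ?y) \<le> c * w x * s ?y"
          using c0 by (metis mult.left_commute mult.commute mult_left_mono)
        moreover have "min (s x) (s ?y) * \<bar>v l ?y\<bar> \<le> min (s x) (s ?y) * (c * w ?y)"
          using c s_nonneg by (intro mult_left_mono) auto
        ultimately have "m ?y * (min (s x) (s ?y) * \<bar>v l ?y\<bar>) \<le> m ?y * (c * w x * s ?y)"
          using m_nonneg by (intro mult_left_mono) auto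
        then show "?g ?y \<le> c * w x * (m ?y * s ?y)" by (simp add: algebra_simps)
      next
        show "summable (\<lambda>i. ?g (i + N))" by (rule summable_ignore_initial_segment[OF sg])
        show "summable (\<lambda>i. c * w x * (m (i + N) * s (i + N)))"
          by (intro summable_mult summable_ignore_initial_segment[OF summable_ms])
      qed
      also have "(\<Sum>i. c * w x * (m (i + N) * s (i + N))) = c * w x * (\<Sum>i. m (i + N) * s (i + N))"
        by (intro suminf_mult summable_ignore_initial_segment[OF summable_ms])
      also have "\<dots> \<le> c * w x * (1 / (2 * l))"
        using N c0 w[of x] by (intro mult_left_mono) auto
      finally have "\<bar>v l x\<bar> \<le> l * (c * w x * (1 / (2 * l)) + (\<Sum>y<N. m y * s y * \<bar>v l y\<bar>))"
        using l by simp
      also have "\<dots> = c / 2 * w x + K" using l by (simp add: K_def field_simps)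
      also have "\<dots> \<le> c / 2 * w x + K * w x"
      proof -
        have "0 \<le> K" using l m_nonneg s_nonneg by (auto simp: K_def intro!: mult_nonneg_nonneg sum_nonneg)
        then show ?thesis using mult_left_mono[OF w(2)[of x], of K] by simp
      qed
      finally show ?thesis using w[of x] by (simp add: field_simps)
    qed
    then have "c \<le> K + c / 2" unfolding c_def by (intro cSUP_least) auto
    then have "c * w x \<le> 2 * K * w x" using w[of x] by (intro mult_right_mono) auto
    then show ?thesis using c[of x] by (simp add: w_def)
  qed
  have "\<bar>v l x\<bar> \<le> 2 * K" for x
  proof (rule LIMSEQ_le_const)
    have "(\<lambda>n. 2 * K * (1 + inverse (real (Suc n)) * s x)) \<longlonglongrightarrow> 2 * K * (1 + 0 * s x)"
      by (intro tendsto_intros LIMSEQ_inverse_real_of_nat)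
    then show "(\<lambda>n. 2 * K * (1 + inverse (real (Suc n)) * s x)) \<longlonglongrightarrow> 2 * K" by simp
    show "\<exists>N. \<forall>n\<ge>N. \<bar>v l x\<bar> \<le> 2 * K * (1 + inverse (real (Suc n)) * s x)"
      by (intro exI[of _ 0] allI impI weighted) auto
  qed
  then show thesis using that by blast
qed

lemma s_F_tendsto_zero:
  assumes W: "flux_limit l = 0"
  shows "(\<lambda>x. s x * F l x) \<longlonglongrightarrow> 0"
proof -
  obtain B where B: "\<And>x. \<bar>v l x\<bar> \<le> B" using v_bounded[OF W] by blast
  define T where "T n = (\<Sum>i. m (i + n) * s (i + n))" for n
  have "T \<longlonglongrightarrow> 0"
    unfolding LIMSEQ_iff T_def using suminf_exist_split[OF _ summable_ms] by auto
  then have T: "(\<lambda>x. l * B * T (Suc x)) \<longlonglongrightarrow> 0"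
    using tendsto_mult_left[OF LIMSEQ_Suc[of T 0], of "l * B"] by simp
  have "norm (s x * F l x) \<le> l * B * T (Suc x)" for x
  proof -
    have l: "0 < l" using flux_limit_zero_pos[OF W] .
    let ?h = "\<lambda>y. s x * (m (y + Suc x) * v l (y + Suc x))"
    have sh: "summable ?h"
      by (intro summable_mult summable_ignore_initial_segment[OF summable_mv])
    have le: "norm (?h y) \<le> B * (m (y + Suc x) * s (y + Suc x))" for y
    proof -
      have "norm (?h y) = m (y + Suc x) * (s x * \<bar>v l (y + Suc x)\<bar>)"
        using m_nonneg[of "y + Suc x"] s_nonneg[of x] by (simp add: abs_mult)
      also have "\<dots> \<le> m (y + Suc x) * (s (y + Suc x) * B)"
        using B m_nonneg s_nonneg s_mono by (intro mult_left_mono mult_mono) auto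
      finally show ?thesis by (simp add: algebra_simps)
    qed
    have sB: "summable (\<lambda>y. B * (m (y + Suc x) * s (y + Suc x)))"
      by (intro summable_mult summable_ignore_initial_segment[OF summable_ms])
    have "norm (\<Sum>y. ?h y) \<le> (\<Sum>y. B * (m (y + Suc x) * s (y + Suc x)))"
      by (rule norm_suminf_le[OF le sB])
    also have "\<dots> = B * T (Suc x)"
      unfolding T_def by (intro suminf_mult summable_ignore_initial_segment[OF summable_ms])
    finally have "l * norm (\<Sum>y. ?h y) \<le> l * (B * T (Suc x))" using l by (intro mult_left_mono) auto
    moreover have "s x * F l x = l * (\<Sum>y. ?h y)"
      using F_eq_tail[of l x] W suminf_mult[OF summable_ignore_initial_segment[OF summable_mv[of l], of "Suc x"], of "s x"]
      by (simp add: mult.left_commute)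
    ultimately show ?thesis using l by (simp add: abs_mult mult.assoc)
  qed
  then show ?thesis by (intro tendsto_norm_zero_cancel[OF tendsto_sandwich[OF _ _ tendsto_const T]]) auto
qed

text \<open>Summation by parts expresses the energy through the flux and the squared norm.\<close>

lemma energy_bounded:
  assumes W: "flux_limit l = 0"
  shows "\<exists>E. \<forall>n. (\<Sum>z<n. a z * (v l (Suc z) - v l z)\<^sup>2) \<le> E"
proof -
  obtain B where B: "\<And>x. \<bar>v l x\<bar> \<le> B" using v_bounded[OF W] by blast
  have B0: "0 \<le> B" using B[of 0] by simp
  have l: "0 < l" using flux_limit_zero_pos[OF W] .
  have eq: "(\<Sum>z<n. a z * (v l (Suc z) - v l z)\<^sup>2) = F l n * v l n + l * (\<Sum>y\<le>n. m y * (v l y)\<^sup>2)" for n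
  proof (induction n)
    case (Suc n)
    have "a n * (v l (Suc n) - v l n)\<^sup>2 = F l n * (v l (Suc n) - v l n)"
      using a_pos[of n] by (simp add: v_Suc power2_eq_square)
    then show ?case using Suc by (simp add: F_Suc power2_eq_square algebra_simps)
  qed simp
  have "(\<Sum>z<n. a z * (v l (Suc z) - v l z)\<^sup>2) \<le> exp (\<bar>l\<bar> * total) * B + l * (B\<^sup>2 * suminf m)" for n
  proof -
    have "F l n * v l n \<le> \<bar>F l n\<bar> * \<bar>v l n\<bar>" by (metis abs_ge_self abs_mult)
    also have "\<dots> \<le> exp (\<bar>l\<bar> * total) * B" using F_bound B by (intro mult_mono) auto
    finally have 1: "F l n * v l n \<le> exp (\<bar>l\<bar> * total) * B" .
    have "(\<Sum>y\<le>n. m y * (v l y)\<^sup>2) \<le> (\<Sum>y\<le>n. m y * B\<^sup>2)"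
      using B m_nonneg B0 by (intro sum_mono mult_left_mono) (auto simp: abs_le_square_iff[symmetric])
    also have "\<dots> = B\<^sup>2 * (\<Sum>y\<le>n. m y)" by (simp add: sum_distrib_right[symmetric])
    also have "\<dots> \<le> B\<^sup>2 * suminf m"
      using summable_m m_nonneg by (intro mult_left_mono sum_le_suminf) auto
    finally have "l * (\<Sum>y\<le>n. m y * (v l y)\<^sup>2) \<le> l * (B\<^sup>2 * suminf m)" using l by (intro mult_left_mono) auto
    with 1 show ?thesis unfolding eq by simp
  qed
  then show ?thesis by blast
qed

text \<open>Conversely, finite energy forces the flux to vanish at infinity, as the total resistance
  is infinite.\<close>

lemma flux_limit_zero_if_energy:
  assumes "\<And>n. (\<Sum>z<n. a z * (v l (Suc z) - v l z)\<^sup>2) \<le> E"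
  shows "flux_limit l = 0"
proof (rule ccontr)
  assume nz: "flux_limit l \<noteq> 0"
  define W where "W = flux_limit l"
  have "0 < (W / 2)\<^sup>2" using nz by (simp add: W_def)
  have "(\<lambda>x. \<bar>F l x\<bar>) \<longlonglongrightarrow> \<bar>W\<bar>" unfolding W_def by (intro tendsto_rabs F_tendsto)
  moreover have "\<bar>W\<bar> / 2 < \<bar>W\<bar>" using nz by (simp add: W_def)
  ultimately have "eventually (\<lambda>x. \<bar>W\<bar> / 2 < \<bar>F l x\<bar>) sequentially" by (rule order_tendstoD)
  then obtain N where N: "\<And>x. x \<ge> N \<Longrightarrow> \<bar>W\<bar> / 2 < \<bar>F l x\<bar>" by (auto simp: eventually_sequentially)
  have le: "(W / 2)\<^sup>2 * (s n - s N) \<le> (\<Sum>z<n. a z * (v l (Suc z) - v l z)\<^sup>2)" if "n \<ge> N" for n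
    using that
  proof (induction n rule: dec_induct)
    case base
    have "0 \<le> (\<Sum>z<N. a z * (v l (Suc z) - v l z)\<^sup>2)"
      by (intro sum_nonneg mult_nonneg_nonneg) (simp_all add: a_pos less_imp_le)
    then show ?case by simp
  next
    case (step n)
    have "(W / 2)\<^sup>2 \<le> (F l n)\<^sup>2"
      using N[OF step(1)] by (intro power2_le_iff_abs_le[THEN iffD2] abs_le_square_iff[THEN iffD1]) auto
    then have "(W / 2)\<^sup>2 / a n \<le> (F l n)\<^sup>2 / a n" using a_pos[of n] by (intro divide_right_mono) auto
    also have "\<dots> = a n * (v l (Suc n) - v l n)\<^sup>2"
      using a_pos[of n] by (simp add: v_Suc power2_eq_square)
    finally show ?case using step by (simp add: s_Suc algebra_simps)
  qed
  obtain M where M: "\<And>x. x \<ge> M \<Longrightarrow> s x > s N + E / (W / 2)\<^sup>2"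
    using s_at_top unfolding filterlim_at_top_dense eventually_sequentially by blast
  define n where "n = max M N"
  have "E < (W / 2)\<^sup>2 * (s n - s N)"
    using M[of n] \<open>0 < (W / 2)\<^sup>2\<close> by (simp add: n_def field_simps)
  also have "\<dots> \<le> E" using le[of n] assms[of n] by (simp add: n_def)
  finally show False by simp
qed

section \<open>Simplicity of the spectrum\<close>

text \<open>If two limits of roots coincide at \<open>c\<close>, then \<open>flux_limit l\<close> is of second order in \<open>l - c\<close>.
  By Lagrange's identity, evaluated at infinity, \<open>\<bar>c - l\<bar>\<close> times the inner product of \<open>v c\<close> and
  \<open>v l\<close> is bounded by a multiple of \<open>\<bar>flux_limit l\<bar>\<close>. Dividing and letting \<open>l\<close> tend to \<open>c\<close>, the
  squared norm of \<open>v c\<close> vanishes.\<close>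

lemma ev_less_ev_Suc: "ev k < ev (Suc k)"
proof (rule ccontr)
  assume "\<not> ev k < ev (Suc k)"
  then have same: "ev (Suc k) = ev k" using ev_le_ev_Suc[of k] by simp
  define c where "c = ev k"
  have c: "0 < c" using ev_pos by (simp add: c_def)
  have W: "flux_limit c = 0" by (simp add: c_def flux_limit_ev)
  obtain B where B: "\<And>x. \<bar>v c x\<bar> \<le> B" using v_bounded[OF W] by blast
  have B0: "0 \<le> B" using B[of 0] by simp
  have dom: "norm (m y * v c y * v l y) \<le> B * exp (L * total) * (m y * s y)" if "\<bar>l\<bar> \<le> L" for l y L
  proof -
    have "\<bar>v l y\<bar> \<le> s y * exp (\<bar>l\<bar> * total)" by (rule v_bound)
    also have "\<dots> \<le> s y * exp (L * total)"
      using that total_nonneg s_nonneg[of y] by (intro mult_left_mono) (auto intro!: mult_right_mono)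
    finally have "norm (m y * v c y * v l y) \<le> m y * B * (s y * exp (L * total))"
      unfolding real_norm_def abs_mult using m_nonneg[of y] B[of y] s_nonneg B0 by (intro mult_mono) auto
    then show ?thesis by (simp add: algebra_simps)
  qed
  have sumg: "summable (\<lambda>y. m y * v c y * v l y)" for l
    by (rule summable_comparison_test'[OF _ dom[of l "\<bar>l\<bar>"]]) (auto intro!: summable_mult summable_ms)
  have bound: "\<bar>c - l\<bar> * \<bar>\<Sum>y. m y * v c y * v l y\<bar> \<le> B * \<bar>flux_limit l\<bar>" for l
  proof (rule LIMSEQ_le)
    show "(\<lambda>x. \<bar>c - l\<bar> * \<bar>\<Sum>y\<le>x. m y * v c y * v l y\<bar>) \<longlonglongrightarrow> \<bar>c - l\<bar> * \<bar>\<Sum>y. m y * v c y * v l y\<bar>"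
      by (intro tendsto_intros summable_LIMSEQ' sumg)
    have "(\<lambda>x. B * \<bar>F l x\<bar> + exp (\<bar>l\<bar> * total) * \<bar>s x * F c x\<bar>) \<longlonglongrightarrow> B * \<bar>flux_limit l\<bar> + exp (\<bar>l\<bar> * total) * \<bar>0\<bar>"
      by (intro tendsto_intros F_tendsto s_F_tendsto_zero[OF W])
    then show "(\<lambda>x. B * \<bar>F l x\<bar> + exp (\<bar>l\<bar> * total) * \<bar>s x * F c x\<bar>) \<longlonglongrightarrow> B * \<bar>flux_limit l\<bar>" by simp
    have "\<bar>c - l\<bar> * \<bar>\<Sum>y\<le>x. m y * v c y * v l y\<bar> \<le> B * \<bar>F l x\<bar> + exp (\<bar>l\<bar> * total) * \<bar>s x * F c x\<bar>" for x
    proof -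
      have "\<bar>c - l\<bar> * \<bar>\<Sum>y\<le>x. m y * v c y * v l y\<bar> = \<bar>v c x * F l x - v l x * F c x\<bar>"
        unfolding lagrange abs_mult ..
      also have "\<dots> \<le> \<bar>v c x\<bar> * \<bar>F l x\<bar> + \<bar>v l x\<bar> * \<bar>F c x\<bar>"
        by (metis abs_mult abs_triangle_ineq4)
      also have "\<dots> \<le> B * \<bar>F l x\<bar> + (s x * exp (\<bar>l\<bar> * total)) * \<bar>F c x\<bar>"
        using B v_bound by (intro add_mono mult_right_mono) auto
      finally show ?thesis using s_nonneg[of x] by (simp add: abs_mult mult_ac)
    qed
    then show "\<exists>N. \<forall>x\<ge>N. \<bar>c - l\<bar> * \<bar>\<Sum>y\<le>x. m y * v c y * v l y\<bar>
        \<le> B * \<bar>F l x\<bar> + exp (\<bar>l\<bar> * total) * \<bar>s x * F c x\<bar>" by blast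
  qed
  define h where "h n = inverse (real (Suc n))" for n
  have h0: "0 < h n" "h n \<le> 1" for n by (auto simp: h_def field_simps)
  have h: "h \<longlonglongrightarrow> 0" unfolding h_def by (rule LIMSEQ_inverse_real_of_nat)
  have small: "\<bar>\<Sum>y. m y * v c y * v (c + h n) y\<bar> \<le> B * (h n / c\<^sup>2) * exp ((c + 1) * bnd)" for n
  proof -
    have "\<bar>flux_limit (c + h n)\<bar> \<le> (\<Prod>j\<in>{k..<Suc (Suc k)}. \<bar>1 - (c + h n) / ev j\<bar>) * exp (\<bar>c + h n\<bar> * bnd)"
      by (rule flux_limit_bound)
    also have "(\<Prod>j\<in>{k..<Suc (Suc k)}. \<bar>1 - (c + h n) / ev j\<bar>) = (h n / c)\<^sup>2"
    proof -
      have "\<bar>1 - (c + h n) / c\<bar> = h n / c" using c h0[of n] by (simp add: add_divide_distrib)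
      then show ?thesis by (simp add: same c_def[symmetric] power2_eq_square)
    qed
    also have "exp (\<bar>c + h n\<bar> * bnd) \<le> exp ((c + 1) * bnd)"
      using c h0[of n] bnd_nonneg by (auto intro!: mult_right_mono)
    finally have "\<bar>flux_limit (c + h n)\<bar> \<le> (h n / c)\<^sup>2 * exp ((c + 1) * bnd)"
      by (simp add: mult_left_mono)
    then have "B * \<bar>flux_limit (c + h n)\<bar> \<le> B * ((h n / c)\<^sup>2 * exp ((c + 1) * bnd))"
      using B0 by (rule mult_left_mono)
    moreover have "h n * \<bar>\<Sum>y. m y * v c y * v (c + h n) y\<bar> \<le> B * \<bar>flux_limit (c + h n)\<bar>"
      using bound[of "c + h n"] h0[of n] by simp
    ultimately have "h n * \<bar>\<Sum>y. m y * v c y * v (c + h n) y\<bar> \<le> h n * (B * (h n / c\<^sup>2) * exp ((c + 1) * bnd))"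
      by (simp add: power2_eq_square field_simps)
    then show ?thesis using h0[of n] mult_le_cancel_left_pos by blast
  qed
  have lim: "(\<lambda>n. \<Sum>y. m y * v c y * v (c + h n) y) \<longlonglongrightarrow> (\<Sum>y. m y * v c y * v c y)"
  proof (rule tannerys_theorem[THEN conjunct2, THEN conjunct2])
    show "(\<lambda>n. m y * v c y * v (c + h n) y) \<longlonglongrightarrow> m y * v c y * v c y" for y
    proof -
      have "(\<lambda>n. c + h n) \<longlonglongrightarrow> c" using tendsto_add[OF tendsto_const h, of c] by simp
      then have "(\<lambda>n. v (c + h n) y) \<longlonglongrightarrow> v c y" unfolding v_def by (rule tendsto_poly)
      then show ?thesis by (intro tendsto_intros)
    qed
    show "\<forall>\<^sub>F (y, n) in sequentially \<times>\<^sub>F sequentially.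
        norm (m y * v c y * v (c + h n) y) \<le> B * exp ((c + 1) * total) * (m y * s y)"
    proof (rule always_eventually, safe)
      fix y n
      have "\<bar>c + h n\<bar> \<le> c + 1" using c h0[of n] by simp
      then show "norm (m y * v c y * v (c + h n) y) \<le> B * exp ((c + 1) * total) * (m y * s y)" by (rule dom)
    qed
    show "summable (\<lambda>y. B * exp ((c + 1) * total) * (m y * s y))" by (intro summable_mult summable_ms)
  qed simp
  have "(\<lambda>n. \<Sum>y. m y * v c y * v (c + h n) y) \<longlonglongrightarrow> 0"
  proof (rule tendsto_norm_zero_cancel[OF tendsto_sandwich[OF _ _ tendsto_const]])
    have "(\<lambda>n. B * (h n / c\<^sup>2) * exp ((c + 1) * bnd)) \<longlonglongrightarrow> B * (0 / c\<^sup>2) * exp ((c + 1) * bnd)"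
      using c by (intro tendsto_intros h) auto
    then show "(\<lambda>n. B * (h n / c\<^sup>2) * exp ((c + 1) * bnd)) \<longlonglongrightarrow> 0" by simp
  qed (use small in auto)
  then have zero: "(\<Sum>y. m y * v c y * v c y) = 0" using lim LIMSEQ_unique by blast
  have nn: "0 \<le> m y * v c y * v c y" for y using m_nonneg[of y] by (simp add: mult.assoc)
  have "0 < v c 1" using a_pos[of 0] by (simp add: v_Suc)
  then have "0 < m 1 * v c 1 * v c 1" using m_pos[of 1] by simp
  then have "0 < (\<Sum>y. m y * v c y * v c y)" by (intro suminf_pos2[OF sumg nn])
  with zero show False by simp
qed

lemma strict_mono_ev: "strict_mono ev"
  using ev_less_ev_Suc by (simp add: strict_mono_Suc_iff)

end

section \<open>The ground state and the chain killed at 1\<close>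

context entrance_chain
begin

lemma recurrence_imp_multiple_of_v:
  assumes f0: "f 0 = 0"
    and rec: "\<And>x. a (Suc x) * (f (Suc (Suc x)) - f (Suc x)) = a x * (f (Suc x) - f x) - l * m (Suc x) * f (Suc x)"
  shows "f x = a 0 * f 1 * v l x"
proof -
  have "f x = a 0 * f 1 * v l x \<and> a x * (f (Suc x) - f x) = a 0 * f 1 * F l x"
  proof (induction x)
    case (Suc x)
    from conjunct2[OF this] have "f (Suc x) - f x = a 0 * f 1 * F l x / a x"
      using a_pos[of x] by (metis less_irrefl nonzero_mult_div_cancel_left)
    then have *: "f (Suc x) = a 0 * f 1 * v l (Suc x)"
      using Suc by (simp add: v_Suc distrib_left)
    show ?case unfolding rec using * Suc by (simp add: F_Suc algebra_simps)
  qed (simp add: f0)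
  then show ?thesis by simp
qed

lemma F_pos:
  assumes "flux_limit l = 0" "l \<le> ev 0"
  shows "0 < F l x"
proof -
  have "0 < (\<Sum>y. m (y + Suc x) * v l (y + Suc x))"
    using v_pos[OF assms(2)] m_pos
    by (intro suminf_pos summable_ignore_initial_segment[OF summable_mv]) auto
  then show ?thesis
    using F_eq_tail[of l x] assms(1) flux_limit_zero_pos[OF assms(1)] by simp
qed

text \<open>The flux is the tail sum of a positive function.\<close>

lemma ground_state_strict_mono:
  assumes "flux_limit l = 0" "l \<le> ev 0"
  shows "strict_mono (v l)"
  using F_pos[OF assms] a_pos by (auto simp: strict_mono_Suc_iff v_Suc)

text \<open>Killing the chain at \<open>1\<close> leaves the edges and states beyond \<open>1\<close>; renumbered, they
  form a chain of the same kind.\<close>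

lemma shifted_chain: "entrance_chain (\<lambda>z. a (Suc z)) (\<lambda>x. m (Suc x))"
proof
  show "\<not> summable (\<lambda>z. 1 / a (Suc z))"
    using not_summable_resistance summable_Suc_iff[of "\<lambda>z. 1 / a z"] by simp
  have shift: "(\<Sum>z<x. 1 / a (Suc z)) = s (Suc x) - s 1" for x
    unfolding s_def by (simp only: sum.lessThan_Suc_shift) simp
  have "norm (m (Suc x) * (\<Sum>z<x. 1 / a (Suc z))) \<le> m (Suc x) * s (Suc x)" for x
    unfolding shift using m_nonneg[of "Suc x"] s_nonneg[of 1] s_mono[of 1 "Suc x"]
    by (simp add: mult_left_mono)
  moreover have "summable (\<lambda>x. m (Suc x) * s (Suc x))"
    using summable_ms summable_Suc_iff[of "\<lambda>x. m x * s x"] by simp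
  ultimately show "summable (\<lambda>x. m (Suc x) * (\<Sum>z<x. 1 / a (Suc z)))"
    by (rule summable_comparison_test'[rotated])
qed (use a_pos m_pos in auto)

definition killed_v :: "real \<Rightarrow> nat \<Rightarrow> real" where
  "killed_v = entrance_chain.v (\<lambda>z. a (Suc z)) (\<lambda>x. m (Suc x))"

definition killed_F :: "real \<Rightarrow> nat \<Rightarrow> real" where
  "killed_F = entrance_chain.F (\<lambda>z. a (Suc z)) (\<lambda>x. m (Suc x))"

definition killed_flux_limit :: "real \<Rightarrow> real" where
  "killed_flux_limit = entrance_chain.flux_limit (\<lambda>z. a (Suc z)) (\<lambda>x. m (Suc x))"

definition killed_ev :: "nat \<Rightarrow> real" where
  "killed_ev = entrance_chain.ev (\<lambda>z. a (Suc z)) (\<lambda>x. m (Suc x))"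

text \<open>The Wronskian of the two shooting solutions started at \<open>0\<close> and at \<open>1\<close>.\<close>

lemma wronskian: "v l (Suc x) * killed_F l x - killed_v l x * F l (Suc x) = 1 / a 0"
proof -
  interpret K: entrance_chain "\<lambda>z. a (Suc z)" "\<lambda>x. m (Suc x)" by (rule shifted_chain)
  have "v l (Suc x) * K.F l x - K.v l x * F l (Suc x) = 1 / a 0"
  proof (induction x)
    case 0
    then show ?case by (simp add: v_Suc)
  next
    case (Suc x)
    have "v l (Suc (Suc x)) * K.F l (Suc x) - K.v l (Suc x) * F l (Suc (Suc x))
        = v l (Suc (Suc x)) * K.F l x - K.v l (Suc x) * F l (Suc x)"
      by (simp add: K.F_Suc F_Suc[of l "Suc x"] algebra_simps)
    also have "\<dots> = v l (Suc x) * K.F l x - K.v l x * F l (Suc x)"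
      using a_pos[of "Suc x"] by (simp add: K.v_Suc v_Suc[of l "Suc x"] field_simps)
    finally show ?case using Suc by simp
  qed
  then show ?thesis by (simp add: killed_v_def killed_F_def)
qed

text \<open>Evaluating the Wronskian at infinity.\<close>

lemma killed_flux_limit_eq:
  assumes W: "flux_limit l = 0" and L: "v l \<longlonglongrightarrow> L"
  shows "L * killed_flux_limit l = v l 1"
proof -
  interpret K: entrance_chain "\<lambda>z. a (Suc z)" "\<lambda>x. m (Suc x)" by (rule shifted_chain)
  have Ks: "K.s x \<le> s (Suc x)" for x
    unfolding K.s_def s_def sum.lessThan_Suc_shift using a_pos[of 0] by simp
  have "(\<lambda>x. K.v l x * F l (Suc x)) \<longlonglongrightarrow> 0"
  proof (rule tendsto_norm_zero_cancel[OF tendsto_sandwich[OF _ _ tendsto_const]])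
    show "(\<lambda>x. exp (\<bar>l\<bar> * K.total) * \<bar>s (Suc x) * F l (Suc x)\<bar>) \<longlonglongrightarrow> 0"
      using tendsto_mult_left[OF tendsto_rabs_zero[OF LIMSEQ_Suc[OF s_F_tendsto_zero[OF W]]], of "exp (\<bar>l\<bar> * K.total)"]
      by simp
    have "norm (K.v l x * F l (Suc x)) \<le> exp (\<bar>l\<bar> * K.total) * \<bar>s (Suc x) * F l (Suc x)\<bar>" for x
    proof -
      have "\<bar>K.v l x\<bar> \<le> K.s x * exp (\<bar>l\<bar> * K.total)" by (rule K.v_bound)
      also have "\<dots> \<le> s (Suc x) * exp (\<bar>l\<bar> * K.total)" using Ks by (intro mult_right_mono) auto
      finally have "\<bar>K.v l x\<bar> * \<bar>F l (Suc x)\<bar> \<le> (s (Suc x) * exp (\<bar>l\<bar> * K.total)) * \<bar>F l (Suc x)\<bar>"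
        by (intro mult_right_mono) auto
      then show ?thesis using s_nonneg[of "Suc x"] by (simp add: abs_mult mult_ac)
    qed
    then show "\<forall>\<^sub>F x in sequentially. norm (K.v l x * F l (Suc x)) \<le> exp (\<bar>l\<bar> * K.total) * \<bar>s (Suc x) * F l (Suc x)\<bar>"
      by simp
  qed simp
  then have "(\<lambda>x. v l (Suc x) * K.F l x - K.v l x * F l (Suc x)) \<longlonglongrightarrow> L * K.flux_limit l - 0"
    by (intro tendsto_intros LIMSEQ_Suc[OF L] K.F_tendsto)
  then have "(\<lambda>x. 1 / a 0) \<longlonglongrightarrow> L * killed_flux_limit l"
    using wronskian[of l] by (simp add: killed_v_def killed_F_def killed_flux_limit_def)
  then have "L * killed_flux_limit l = 1 / a 0" by (simp add: LIMSEQ_const_iff)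
  then show ?thesis by (simp add: v_Suc)
qed

text \<open>If the killed chain had the smaller ground energy \<open>l\<close>, then both shooting solutions and the
  flux of the one started at \<open>0\<close> would be nonnegative there, while the flux of its eigenfunction
  decays: the Wronskian could not stay positive.\<close>

lemma ev_less_killed_ev: "ev 0 < killed_ev 0"
proof (rule ccontr)
  interpret K: entrance_chain "\<lambda>z. a (Suc z)" "\<lambda>x. m (Suc x)" by (rule shifted_chain)
  define l where "l = K.ev 0"
  assume "\<not> ev 0 < killed_ev 0"
  then have le: "l \<le> ev 0" by (simp add: l_def killed_ev_def)
  have W: "K.flux_limit l = 0" by (simp add: l_def K.flux_limit_ev)
  have l: "0 < l" by (simp add: l_def K.ev_pos)
  have vpos: "0 \<le> v l x" for x using v_pos[OF le] by (cases x) (auto intro: less_imp_le)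
  have "0 \<le> flux_limit l"
    using vpos s_nonneg by (intro LIMSEQ_le_const[OF v_over_s_tendsto]) auto
  moreover have "0 \<le> (\<Sum>y. m (y + Suc x) * v l (y + Suc x))" for x
    using vpos m_nonneg by (intro suminf_nonneg summable_ignore_initial_segment[OF summable_mv]) auto
  ultimately have Fpos: "0 \<le> F l x" for x
    unfolding F_eq_tail[of l x] using l by (intro add_nonneg_nonneg mult_nonneg_nonneg) auto
  have KF: "0 < K.F l x" for x using K.F_pos[OF W] by (simp add: l_def)
  have Kv: "0 \<le> K.v l x" for x
    using K.v_pos[of l] by (cases x) (auto simp: l_def intro: less_imp_le)
  define C where "C = exp (\<bar>l\<bar> * total)"
  have Ks: "s (Suc x) = 1 / a 0 + K.s x" for x
    unfolding K.s_def s_def sum.lessThan_Suc_shift by simp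
  have "1 / a 0 \<le> C * (1 / a 0 * K.F l x + K.s x * K.F l x)" for x
  proof -
    have "1 / a 0 \<le> v l (Suc x) * K.F l x"
      using wronskian[of l x] mult_nonneg_nonneg[OF Kv[of x] Fpos[of "Suc x"]]
      by (simp add: killed_v_def killed_F_def)
    also have "\<dots> \<le> (s (Suc x) * C) * K.F l x"
      using v_bound[of l "Suc x"] KF[of x] by (intro mult_right_mono) (auto simp: C_def)
    finally show ?thesis by (simp add: Ks algebra_simps)
  qed
  moreover have "(\<lambda>x. C * (1 / a 0 * K.F l x + K.s x * K.F l x)) \<longlonglongrightarrow> C * (1 / a 0 * 0 + 0)"
    using K.F_tendsto[of l] W by (intro tendsto_intros K.s_F_tendsto_zero[OF W]) simp
  ultimately have "1 / a 0 \<le> C * (1 / a 0 * 0 + 0)"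
    by (intro LIMSEQ_le_const[of "\<lambda>x. C * (1 / a 0 * K.F l x + K.s x * K.F l x)"]) auto
  then show False using a_pos[of 0] by (simp add: field_simps)
qed

text \<open>By the Wronskian, the values of \<^term>\<open>killed_v\<close> at the roots of \<^term>\<open>v\<close> alternate in sign.
  Hence the truncated eigenvalues of the killed chain lie between those of the chain; in the
  factorisation of the shooting polynomial of the killed chain all of them except the lowest may be
  replaced by eigenvalues of the chain itself.\<close>

lemma killed_v_lower_bound:
  "(1 - ev 0 / killed_ev 0) * (\<Prod>k<n. 1 - ev 0 / ev (Suc k))
    \<le> killed_v (ev 0) (Suc (Suc n)) / killed_v 0 (Suc (Suc n))"
proof -
  interpret K: entrance_chain "\<lambda>z. a (Suc z)" "\<lambda>x. m (Suc x)" by (rule shifted_chain)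
  define N where "N = Suc n"
  define t where "t k = trunc_ev (Suc N) k" for k
  define p where "p = sol (\<lambda>z. a (Suc z)) (\<lambda>x. m (Suc x)) (Suc N)"
  have p: "poly p x = K.v x (Suc N)" for x by (simp add: p_def K.v_def)
  obtain \<rho> where between: "\<And>k. k < N \<Longrightarrow> t k < \<rho> k \<and> \<rho> k < t (Suc k)"
    and fac: "\<And>x. poly p x = poly p 0 * (\<Prod>j<N. 1 - x / \<rho> j)"
  proof (rule alternating_roots[of p N t])
    show "degree p \<le> N" unfolding p_def by (rule K.degree_sol)
    show "0 \<le> t 0" using trunc_ev_pos[of 0 "Suc N"] by (simp add: t_def)
    show "t i < t j" if "i < j" "j \<le> N" for i j
      unfolding t_def using that by (intro trunc_ev_less) auto
    show "0 < (-1) ^ k * poly p (t k)" if "k \<le> N" for k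
    proof -
      define l where "l = t k"
      have v0: "v l (Suc (Suc N)) = 0"
        unfolding v_factor using that trunc_ev_pos[of k "Suc N"]
        by (auto intro!: prod_zero bexI[of _ k] simp: l_def t_def)
      have "F l (Suc N) = - (a (Suc N) * v l (Suc N))"
        using v0 a_pos[of "Suc N"] by (simp add: v_Suc[of l "Suc N"] field_simps)
      moreover have "F l (Suc (Suc N)) = F l (Suc N)" by (simp add: F_Suc[of l "Suc N"] v0)
      moreover have "- (K.v l (Suc N) * F l (Suc (Suc N))) = 1 / a 0"
        using wronskian[of l "Suc N"] v0 by (simp add: killed_v_def)
      ultimately have "a (Suc N) * (K.v l (Suc N) * v l (Suc N)) = 1 / a 0"
        by (simp add: mult_ac)
      then have "0 < a (Suc N) * (K.v l (Suc N) * v l (Suc N))" using a_pos[of 0] by simp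
      then have "0 < K.v l (Suc N) * v l (Suc N)" using a_pos zero_less_mult_pos by blast
      moreover have "0 < (-1) ^ k * v l (Suc N)"
        using trunc_ev_sign[of k "Suc N"] that by (simp add: l_def t_def)
      ultimately show ?thesis
        unfolding p l_def[symmetric] by (cases "even k") (auto simp: zero_less_mult_iff)
    qed
  qed blast
  have gt: "ev k < \<rho> k" if "k < N" for k
    using between[OF that] ev_less_trunc_ev[of k "Suc N"] that by (simp add: t_def)
  have "K.ev 0 < \<rho> 0"
  proof -
    have "poly p (\<rho> 0) = 0"
      using gt[of 0] ev_pos[of 0] by (subst fac) (auto intro!: prod_zero bexI[of _ 0] simp: N_def)
    then have "(\<Prod>j<N. 1 - \<rho> 0 / K.trunc_ev N j) = 0"
      unfolding p K.v_factor using K.s_pos[of "Suc N"] by simp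
    then obtain j where j: "j < N" "\<rho> 0 = K.trunc_ev N j"
      using K.trunc_ev_pos[of _ N] by (auto simp: field_simps)
    have "K.ev 0 < K.trunc_ev N 0" using j by (intro K.ev_less_trunc_ev) auto
    also have "\<dots> \<le> \<rho> 0" using j K.trunc_ev_less[of 0 j N] by (cases j) auto
    finally show ?thesis .
  qed
  then have fst: "1 - ev 0 / killed_ev 0 \<le> 1 - ev 0 / \<rho> 0"
    using K.ev_pos[of 0] ev_pos[of 0] by (simp add: killed_ev_def divide_left_mono)
  have fst0: "0 \<le> 1 - ev 0 / killed_ev 0"
    using ev_less_killed_ev ev_pos[of 0] by simp
  have le0: "0 \<le> 1 - ev 0 / ev (Suc k)" for k
    using strict_monoD[OF strict_mono_ev, of 0 "Suc k"] ev_pos[of 0] by simp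
  have "(\<Prod>k<n. 1 - ev 0 / ev (Suc k)) \<le> (\<Prod>k<n. 1 - ev 0 / \<rho> (Suc k))"
  proof (intro prod_mono conjI le0)
    fix k assume "k \<in> {..<n}"
    then have "ev (Suc k) < \<rho> (Suc k)" by (intro gt) (simp add: N_def)
    then show "1 - ev 0 / ev (Suc k) \<le> 1 - ev 0 / \<rho> (Suc k)"
      using ev_pos[of 0] ev_pos[of "Suc k"] by (simp add: divide_left_mono)
  qed
  then have "(1 - ev 0 / killed_ev 0) * (\<Prod>k<n. 1 - ev 0 / ev (Suc k))
      \<le> (1 - ev 0 / \<rho> 0) * (\<Prod>k<n. 1 - ev 0 / \<rho> (Suc k))"
    using fst fst0 le0 by (intro mult_mono prod_nonneg) auto
  also have "\<dots> = (\<Prod>k<N. 1 - ev 0 / \<rho> k)"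
    by (simp only: N_def prod.lessThan_Suc_shift)
  also have "\<dots> = K.v (ev 0) (Suc N) / K.v 0 (Suc N)"
    using fac[of "ev 0"] K.s_pos[of "Suc N"] unfolding p by (simp add: K.v_zero_arg)
  finally show ?thesis by (simp add: N_def killed_v_def)
qed

lemma ev_ratio_less_one: "ev 0 / ev (Suc k) < 1"
  using strict_monoD[OF strict_mono_ev, of 0 "Suc k"] ev_pos[of 0] by simp

lemma convergent_prod_ev: "convergent_prod (\<lambda>k. 1 - ev 0 / ev (Suc k))"
proof -
  have "summable (\<lambda>k. 1 / ev (Suc k))" using summable_inverse_ev summable_Suc_iff[of "\<lambda>k. 1 / ev k"] by simp
  then have "summable (\<lambda>k. ev 0 * (1 / ev (Suc k)))" by (intro summable_mult)
  then have "summable (\<lambda>k. ev 0 / ev (Suc k))" by simp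
  moreover have "- (ev 0 / ev (Suc k)) \<noteq> -1" for k using ev_ratio_less_one[of k] by linarith
  ultimately have "convergent_prod (\<lambda>k. 1 + - (ev 0 / ev (Suc k)))"
    using ev_pos by (intro abs_convergent_prod_imp_convergent_prod summable_imp_abs_convergent_prod)
      (simp add: less_imp_le)
  then show ?thesis by simp
qed

lemma prodinf_ev_pos: "0 < (\<Prod>k. 1 - ev 0 / ev (Suc k))"
  using convergent_prod_ev ev_ratio_less_one by (intro less_0_prodinf) auto

lemma killed_flux_limit_lower_bound:
  "(1 - ev 0 / killed_ev 0) * (\<Prod>k. 1 - ev 0 / ev (Suc k)) \<le> killed_flux_limit (ev 0)"
proof (rule LIMSEQ_le)
  interpret K: entrance_chain "\<lambda>z. a (Suc z)" "\<lambda>x. m (Suc x)" by (rule shifted_chain)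
  have "(\<lambda>n. \<Prod>k\<le>n. 1 - ev 0 / ev (Suc k)) \<longlonglongrightarrow> (\<Prod>k. 1 - ev 0 / ev (Suc k))"
    by (rule convergent_prod_LIMSEQ[OF convergent_prod_ev])
  then show "(\<lambda>n. (1 - ev 0 / killed_ev 0) * (\<Prod>k<Suc n. 1 - ev 0 / ev (Suc k)))
      \<longlonglongrightarrow> (1 - ev 0 / killed_ev 0) * (\<Prod>k. 1 - ev 0 / ev (Suc k))"
    unfolding lessThan_Suc_atMost by (intro tendsto_intros)
  show "(\<lambda>n. killed_v (ev 0) (Suc (Suc (Suc n))) / killed_v 0 (Suc (Suc (Suc n)))) \<longlonglongrightarrow> killed_flux_limit (ev 0)"
    unfolding killed_v_def killed_flux_limit_def K.v_zero_arg
    by (intro LIMSEQ_Suc[of "\<lambda>n. K.v (ev 0) (Suc (Suc n)) / K.s (Suc (Suc n))"]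
        LIMSEQ_Suc[of "\<lambda>n. K.v (ev 0) (Suc n) / K.s (Suc n)"] LIMSEQ_Suc[of "\<lambda>n. K.v (ev 0) n / K.s n"]
        K.v_over_s_tendsto)
  show "\<exists>N. \<forall>n\<ge>N. (1 - ev 0 / killed_ev 0) * (\<Prod>k<Suc n. 1 - ev 0 / ev (Suc k))
      \<le> killed_v (ev 0) (Suc (Suc (Suc n))) / killed_v 0 (Suc (Suc (Suc n)))"
    using killed_v_lower_bound by blast
qed

text \<open>By \<open>killed_flux_limit_eq\<close> the amplitude is exactly the reciprocal of
  \<^term>\<open>killed_flux_limit (ev 0)\<close>.\<close>

lemma ground_state_amplitude:
  assumes c: "0 < c" and \<psi>: "\<And>x. \<psi> x = c * v (ev 0) x"
  shows "strict_mono \<psi>" "bounded (range \<psi>)" "convergent \<psi>"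
    "(SUP x\<in>{1..}. \<psi> x) / (INF y\<in>{1..}. \<psi> y) = lim \<psi> / \<psi> 1"
    "lim \<psi> / \<psi> 1 \<le> inverse ((1 - ev 0 / killed_ev 0) * (\<Prod>k. 1 - ev 0 / ev (Suc k)))"
proof -
  have W: "flux_limit (ev 0) = 0" by (rule flux_limit_ev)
  show mono: "strict_mono \<psi>"
    using ground_state_strict_mono[OF W] c by (simp add: strict_mono_def \<psi>)
  have inc: "incseq \<psi>" using mono by (simp add: incseq_def strict_mono_less_eq)
  obtain B where "\<And>x. \<bar>v (ev 0) x\<bar> \<le> B" using v_bounded[OF W] by blast
  then have B: "\<bar>\<psi> x\<bar> \<le> c * B" for x using c by (simp add: \<psi> abs_mult)
  then show "bounded (range \<psi>)" by (auto simp: bounded_iff)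
  have "\<psi> x \<le> c * B" for x using B[of x] by linarith
  then obtain M where M: "\<psi> \<longlonglongrightarrow> M" and le: "\<And>x. \<psi> x \<le> M"
    using incseq_convergent[OF inc] by blast
  show "convergent \<psi>" using M by (rule convergentI)
  have lim: "lim \<psi> = M" using M by (rule limI)
  have "(SUP x\<in>{1..}. \<psi> x) = M"
  proof (rule cSup_eq_non_empty)
    show "y \<le> M" if "y \<in> \<psi> ` {1..}" for y using that le by auto
    show "M \<le> y" if "\<And>x. x \<in> \<psi> ` {1..} \<Longrightarrow> x \<le> y" for y
      using that by (intro LIMSEQ_le_const2[OF M]) auto
  qed simp
  moreover have "(INF y\<in>{1..}. \<psi> y) = \<psi> 1"
    using inc by (intro cInf_eq_minimum) (auto simp: incseq_def)
  ultimately show "(SUP x\<in>{1..}. \<psi> x) / (INF y\<in>{1..}. \<psi> y) = lim \<psi> / \<psi> 1" by (simp add: lim)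
  define P where "P = (1 - ev 0 / killed_ev 0) * (\<Prod>k. 1 - ev 0 / ev (Suc k))"
  have "0 < 1 - ev 0 / killed_ev 0" using ev_less_killed_ev ev_pos[of 0] by simp
  then have P: "0 < P" unfolding P_def using prodinf_ev_pos by (intro mult_pos_pos)
  have "(\<lambda>x. \<psi> x / c) \<longlonglongrightarrow> M / c" using c by (intro tendsto_intros M) auto
  then have "v (ev 0) \<longlonglongrightarrow> M / c" using c by (simp add: \<psi>)
  then have "M / c * killed_flux_limit (ev 0) = v (ev 0) 1" by (rule killed_flux_limit_eq[OF W])
  then have eq: "M * killed_flux_limit (ev 0) = \<psi> 1" using c by (simp add: \<psi> field_simps)
  have pos: "0 < \<psi> 1" using c v_pos[of "ev 0" 0] by (simp add: \<psi>)
  have "0 < M" using pos le[of 1] by simp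
  have "P \<le> killed_flux_limit (ev 0)" unfolding P_def by (rule killed_flux_limit_lower_bound)
  then have "M * P \<le> \<psi> 1" unfolding eq[symmetric] using \<open>0 < M\<close> by (intro mult_left_mono) auto
  then show "lim \<psi> / \<psi> 1 \<le> inverse ((1 - ev 0 / killed_ev 0) * (\<Prod>k. 1 - ev 0 / ev (Suc k)))"
    unfolding lim P_def[symmetric] using P pos by (simp add: field_simps)
qed

end

section \<open>The Friedrichs extension in terms of the recurrence\<close>

lemma weighted_Cauchy_Schwarz_sum:
  fixes w f g :: "nat \<Rightarrow> real"
  assumes "\<And>i. i \<in> I \<Longrightarrow> 0 \<le> w i"
  shows "(\<Sum>i\<in>I. w i * f i * g i)\<^sup>2 \<le> (\<Sum>i\<in>I. w i * (f i)\<^sup>2) * (\<Sum>i\<in>I. w i * (g i)\<^sup>2)"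
proof -
  have "(\<Sum>i\<in>I. (sqrt (w i) * f i) * (sqrt (w i) * g i))\<^sup>2
      \<le> (\<Sum>i\<in>I. (sqrt (w i) * f i)\<^sup>2) * (\<Sum>i\<in>I. (sqrt (w i) * g i)\<^sup>2)"
    by (rule Cauchy_Schwarz_ineq_sum)
  moreover have "(sqrt (w i) * f i) * (sqrt (w i) * g i) = w i * f i * g i"
    "(sqrt (w i) * f i)\<^sup>2 = w i * (f i)\<^sup>2" "(sqrt (w i) * g i)\<^sup>2 = w i * (g i)\<^sup>2" if "i \<in> I" for i
    using assms[OF that] by (simp_all add: power_mult_distrib mult_ac flip: real_sqrt_mult)
  ultimately show ?thesis by (simp cong: sum.cong)
qed

lemma square_add_le: "(x + y)\<^sup>2 \<le> 2 * x\<^sup>2 + 2 * (y::real)\<^sup>2"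
  using sum_squares_bound[of x y] by (simp add: power2_sum)

text \<open>\<open>A\<close> is minus the generator in divergence form, on functions vanishing up to the state \<open>k\<close>. The
  case \<open>k = 0\<close> is the chain absorbed at \<open>0\<close>, the case \<open>k = 1\<close> the chain killed at \<open>1\<close>.\<close>

locale dirichlet_form = entrance_chain +
  fixes k :: nat and A :: "(nat \<Rightarrow> real) \<Rightarrow> nat \<Rightarrow> real"
  assumes A_eq: "\<And>f y. k \<le> y \<Longrightarrow>
    m (Suc y) * A f (Suc y) = a y * (f (Suc y) - f y) - a (Suc y) * (f (Suc (Suc y)) - f (Suc y))"
begin

abbreviation S :: "nat set" where "S \<equiv> {Suc k..}"

text \<open>Partial sums of the energy; statements about the energy are made uniformly in \<open>n\<close>, so that no
  summability has to be known in advance.\<close>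

definition en :: "nat \<Rightarrow> (nat \<Rightarrow> real) \<Rightarrow> real" where
  "en n f = (\<Sum>z<n. a z * (f (Suc z) - f z)\<^sup>2)"

lemma en_mono: "n \<le> n' \<Longrightarrow> en n f \<le> en n' f"
  unfolding en_def by (intro sum_mono2) (simp_all add: a_pos less_imp_le)

lemma en_add_le: "en n (\<lambda>x. f x + g x) \<le> 2 * en n f + 2 * en n g"
proof -
  have "a z * ((f (Suc z) + g (Suc z)) - (f z + g z))\<^sup>2
      \<le> 2 * (a z * (f (Suc z) - f z)\<^sup>2) + 2 * (a z * (g (Suc z) - g z)\<^sup>2)" for z
    using mult_left_mono[OF square_add_le[of "f (Suc z) - f z" "g (Suc z) - g z"] less_imp_le[OF a_pos[of z]]]
    by (simp add: algebra_simps)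
  then show ?thesis
    unfolding en_def sum_distrib_left sum.distrib[symmetric] by (intro sum_mono) auto
qed

lemma en_minus_le: "en n (\<lambda>x. f x - g x) \<le> 2 * en n f + 2 * en n g"
proof -
  have "en n (\<lambda>x. - g x) = en n g" by (simp add: en_def power2_commute)
  then show ?thesis using en_add_le[of n f "\<lambda>x. - g x"] by simp
qed

lemma l2_iff: "f \<in> l2 S m \<longleftrightarrow> (\<forall>x\<le>k. f x = 0) \<and> summable (\<lambda>x. m x * (f x)\<^sup>2)"
proof (cases "\<forall>x\<le>k. f x = 0")
  case True
  then have "(\<lambda>x. m x * (f x)\<^sup>2) summable_on S \<longleftrightarrow> (\<lambda>x. m x * (f x)\<^sup>2) summable_on UNIV"
    by (intro summable_on_cong_neutral) auto
  then show ?thesis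
    using True m_nonneg by (auto simp: l2_def summable_on_UNIV_nonneg_real_iff not_less_eq_eq)
qed (auto simp: l2_def not_less_eq_eq)

lemma summable_l2_prod:
  assumes "f \<in> l2 S m" "g \<in> l2 S m"
  shows "summable (\<lambda>x. norm (m x * f x * g x))"
proof (rule summable_comparison_test')
  show "summable (\<lambda>x. m x * (f x)\<^sup>2 + m x * (g x)\<^sup>2)" using assms by (intro summable_add) (auto simp: l2_iff)
  fix x :: nat
  have "\<bar>f x\<bar> * \<bar>g x\<bar> \<le> (f x)\<^sup>2 + (g x)\<^sup>2"
    using sum_squares_bound[of "\<bar>f x\<bar>" "\<bar>g x\<bar>"] mult_nonneg_nonneg[of "\<bar>f x\<bar>" "\<bar>g x\<bar>"] by (simp del: mult_nonneg_nonneg)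
  then show "norm (norm (m x * f x * g x)) \<le> m x * (f x)\<^sup>2 + m x * (g x)\<^sup>2"
    using mult_left_mono[OF _ m_nonneg[of x]] m_nonneg[of x]
    by (simp add: abs_mult mult.assoc flip: distrib_left)
qed

lemma l2_inner_eq:
  assumes "f \<in> l2 S m" "g \<in> l2 S m"
  shows "l2_inner S m f g = (\<Sum>x. m x * f x * g x)"
proof -
  have "((\<lambda>x. m x * f x * g x) has_sum (\<Sum>x. m x * f x * g x)) UNIV"
    by (rule norm_summable_imp_has_sum[OF summable_l2_prod[OF assms]
          summable_sums[OF summable_norm_cancel[OF summable_l2_prod[OF assms]]]])
  then have "((\<lambda>x. m x * f x * g x) has_sum (\<Sum>x. m x * f x * g x)) S"
    using assms by (subst has_sum_cong_neutral[where T = UNIV and g = "\<lambda>x. m x * f x * g x"]) (auto simp: l2_iff not_less_eq_eq)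
  then show ?thesis unfolding l2_inner_def by (rule infsumI)
qed

lemma fin_suppE:
  assumes "g \<in> fin_supp S"
  obtains N where "\<And>x. N \<le> x \<Longrightarrow> g x = 0"
proof -
  have "finite {x. g x \<noteq> 0}" using assms by (simp add: fin_supp_def)
  then obtain N where "\<forall>x\<in>{x. g x \<noteq> 0}. x < N" using finite_nat_set_iff_bounded by blast
  then show thesis by (intro that[of N]) (metis (mono_tags) mem_Collect_eq not_less)
qed

lemma fin_supp_zero: "g \<in> fin_supp S \<Longrightarrow> x \<le> k \<Longrightarrow> g x = 0"
  by (force simp: fin_supp_def)

lemma fin_supp_diff: "f \<in> fin_supp S \<Longrightarrow> g \<in> fin_supp S \<Longrightarrow> (\<lambda>x. f x - g x) \<in> fin_supp S"
proof -
  assume "f \<in> fin_supp S" "g \<in> fin_supp S"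
  moreover have "{x. f x - g x \<noteq> 0} \<subseteq> {x. f x \<noteq> 0} \<union> {x. g x \<noteq> 0}" by auto
  ultimately show ?thesis unfolding fin_supp_def by (auto intro: finite_subset)
qed

lemma fin_supp_l2: "f \<in> fin_supp S \<Longrightarrow> f \<in> l2 S m"
proof -
  assume f: "f \<in> fin_supp S"
  obtain N where "\<And>x. N \<le> x \<Longrightarrow> f x = 0" using fin_suppE[OF f] by blast
  then have "summable (\<lambda>x. m x * (f x)\<^sup>2)" by (intro summable_finite[of "{..<N}"]) auto
  then show ?thesis using fin_supp_zero[OF f] by (simp add: l2_iff)
qed

lemma l2_diff: "f \<in> l2 S m \<Longrightarrow> g \<in> l2 S m \<Longrightarrow> (\<lambda>x. f x - g x) \<in> l2 S m"
proof -
  assume fg: "f \<in> l2 S m" "g \<in> l2 S m"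
  have "summable (\<lambda>x. m x * (f x - g x)\<^sup>2)"
  proof (rule summable_comparison_test')
    show "summable (\<lambda>x. 2 * (m x * (f x)\<^sup>2) + 2 * (m x * (g x)\<^sup>2))"
      using fg by (intro summable_add summable_mult) (auto simp: l2_iff)
    fix x :: nat
    show "norm (m x * (f x - g x)\<^sup>2) \<le> 2 * (m x * (f x)\<^sup>2) + 2 * (m x * (g x)\<^sup>2)"
      using mult_left_mono[OF square_add_le[of "f x" "- g x"] m_nonneg[of x]] m_nonneg[of x]
      by (simp add: distrib_left)
  qed
  then show ?thesis using fg by (simp add: l2_iff)
qed

lemma l2_inner_fin_supp:
  assumes g: "\<And>x. x \<le> k \<Longrightarrow> g x = 0" "\<And>x. N \<le> x \<Longrightarrow> g x = 0"
  shows "l2_inner S m h g = (\<Sum>y<N. m (Suc y) * h (Suc y) * g (Suc y))"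
proof -
  have "l2_inner S m h g = infsum (\<lambda>x. m x * h x * g x) (Suc ` {..<N})"
    unfolding l2_inner_def
  proof (rule infsum_cong_neutral)
    show "m x * h x * g x = 0" if "x \<in> S - Suc ` {..<N}" for x
      using that g(2)[of x] by (cases x) (auto simp: inj_image_mem_iff)
    show "m x * h x * g x = 0" if "x \<in> Suc ` {..<N} - S" for x using that g(1)[of x] by auto
  qed auto
  also have "\<dots> = (\<Sum>x\<in>Suc ` {..<N}. m x * h x * g x)" by simp
  also have "\<dots> = (\<Sum>y<N. m (Suc y) * h (Suc y) * g (Suc y))" by (subst sum.reindex) auto
  finally show ?thesis .
qed

text \<open>Summation by parts.\<close>

lemma form_eq:
  assumes g: "g \<in> fin_supp S" "\<And>x. N \<le> x \<Longrightarrow> g x = 0"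
  shows "l2_inner S m (A f) g = (\<Sum>z<N. a z * (f (Suc z) - f z) * (g (Suc z) - g z))"
proof -
  note g0 = fin_supp_zero[OF g(1)]
  have "(\<Sum>y<n. m (Suc y) * A f (Suc y) * g (Suc y))
      = (\<Sum>z<n. a z * (f (Suc z) - f z) * (g (Suc z) - g z)) - a n * (f (Suc n) - f n) * g n" for n
  proof (induction n)
    case (Suc n)
    have "m (Suc n) * A f (Suc n) * g (Suc n)
        = (a n * (f (Suc n) - f n) - a (Suc n) * (f (Suc (Suc n)) - f (Suc n))) * g (Suc n)"
      using A_eq[of n f] g0[of "Suc n"] by (cases "k \<le> n") auto
    then show ?case using Suc by (simp add: algebra_simps)
  qed (simp add: g0)
  from this[of N] show ?thesis using l2_inner_fin_supp[OF g0 g(2), where h = "A f"] g(2)[of N] by simp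
qed

lemma en_le_form:
  assumes "u \<in> fin_supp S"
  shows "en n u \<le> l2_inner S m (A u) u"
proof -
  obtain N where N: "\<And>x. N \<le> x \<Longrightarrow> u x = 0" using fin_suppE[OF assms] by blast
  have "l2_inner S m (A u) u = en (max n N) u"
    unfolding en_def using form_eq[OF assms, where N = "max n N" and f = u] N by (simp add: power2_eq_square mult.assoc)
  then show ?thesis using en_mono[of n "max n N" u] by simp
qed

lemma form_eq_en:
  assumes "u \<in> fin_supp S"
  obtains N where "l2_inner S m (A u) u = en N u"
proof -
  obtain N where "\<And>x. N \<le> x \<Longrightarrow> u x = 0" using fin_suppE[OF assms] by blast
  then have "l2_inner S m (A u) u = en N u"
    unfolding en_def using form_eq[OF assms, where N = N and f = u] by (simp add: power2_eq_square mult.assoc)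
  then show thesis by (rule that)
qed

abbreviation approx :: "(nat \<Rightarrow> nat \<Rightarrow> real) \<Rightarrow> (nat \<Rightarrow> real) \<Rightarrow> bool" where
  "approx u f \<equiv> form_approx S m (fin_supp S) A u f"

lemma approx_l2: "approx u f \<Longrightarrow> f \<in> l2 S m" and approx_fin: "approx u f \<Longrightarrow> u n \<in> fin_supp S"
  by (auto simp: form_approx_def)

lemma l2_square_tendsto_imp_pointwise:
  assumes "\<And>n. w n \<in> l2 S m" "(\<lambda>n. l2_inner S m (w n) (w n)) \<longlonglongrightarrow> 0"
  shows "(\<lambda>n. w n x) \<longlonglongrightarrow> 0"
proof -
  have "m x * (w n x)\<^sup>2 \<le> l2_inner S m (w n) (w n)" for n
  proof -
    have "summable (\<lambda>x. m x * (w n x)\<^sup>2)" using assms(1) by (simp add: l2_iff)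
    then have "(\<Sum>y\<in>{x}. m y * (w n y)\<^sup>2) \<le> (\<Sum>y. m y * (w n y)\<^sup>2)"
      using m_nonneg by (intro sum_le_suminf) auto
    then show ?thesis using l2_inner_eq[OF assms(1) assms(1), of n n] by (simp add: power2_eq_square mult.assoc)
  qed
  then have "(\<lambda>n. m x * (w n x)\<^sup>2) \<longlonglongrightarrow> 0"
    using m_nonneg by (intro tendsto_sandwich[OF _ _ tendsto_const assms(2)]) auto
  then have "(\<lambda>n. (1 / m x) * (m x * (w n x)\<^sup>2)) \<longlonglongrightarrow> (1 / m x) * 0" by (intro tendsto_intros)
  then have "(\<lambda>n. (w n x)\<^sup>2) \<longlonglongrightarrow> 0" using m_pos[of x] by simp
  then show ?thesis by (simp add: power_tendsto_0_iff)
qed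

lemma approx_pointwise:
  assumes "approx u f"
  shows "(\<lambda>n. u n x) \<longlonglongrightarrow> f x"
proof -
  have "(\<lambda>n. u n x - f x) \<longlonglongrightarrow> 0"
  proof (rule l2_square_tendsto_imp_pointwise)
    show "(\<lambda>x. u n x - f x) \<in> l2 S m" for n
      by (intro l2_diff fin_supp_l2 approx_fin[OF assms] approx_l2[OF assms])
    show "(\<lambda>n. l2_inner S m (\<lambda>x. u n x - f x) (\<lambda>x. u n x - f x)) \<longlonglongrightarrow> 0"
      using assms by (simp add: form_approx_def)
  qed
  then show ?thesis by (rule LIM_zero_cancel)
qed

text \<open>Fatou: the form Cauchy property passes to the pointwise limit.\<close>

lemma approx_en_tendsto:
  assumes u: "approx u f" and e: "0 < e"
  obtains N where "\<And>n M. N \<le> n \<Longrightarrow> en M (\<lambda>x. u n x - f x) \<le> e"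
proof -
  obtain N where N: "\<And>i j. i \<ge> N \<Longrightarrow> j \<ge> N \<Longrightarrow>
      l2_inner S m (A (\<lambda>x. u i x - u j x)) (\<lambda>x. u i x - u j x) < e"
    using u e unfolding form_approx_def by blast
  have "en M (\<lambda>x. u n x - f x) \<le> e" if "N \<le> n" for n M
  proof (rule LIMSEQ_le_const2)
    show "(\<lambda>j. en M (\<lambda>x. u n x - u j x)) \<longlonglongrightarrow> en M (\<lambda>x. u n x - f x)"
      unfolding en_def by (intro tendsto_intros approx_pointwise[OF u])
    have "en M (\<lambda>x. u n x - u j x) \<le> e" if "N \<le> j" for j
      using N[OF \<open>N \<le> n\<close> that] en_le_form[OF fin_supp_diff[OF approx_fin[OF u, of n] approx_fin[OF u, of j]], of M]
      by simp
    then show "\<exists>N. \<forall>j\<ge>N. en M (\<lambda>x. u n x - u j x) \<le> e" by blast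
  qed
  then show thesis by (rule that)
qed

lemma approx_en_bounded:
  assumes u: "approx u f"
  obtains N E where "0 \<le> E" "\<And>n M. N \<le> n \<Longrightarrow> en M (u n) \<le> E" "\<And>M. en M f \<le> E"
proof -
  obtain N where N: "\<And>n M. N \<le> n \<Longrightarrow> en M (\<lambda>x. u n x - f x) \<le> 1"
    using approx_en_tendsto[OF u, of 1] by auto
  define E where "E = l2_inner S m (A (u N)) (u N)"
  have E: "en M (u N) \<le> E" for M unfolding E_def by (rule en_le_form[OF approx_fin[OF u]])
  have f: "en M f \<le> 2 * E + 2" for M
    using en_minus_le[of M "u N" "\<lambda>x. u N x - f x"] E[of M] N[of N M] by simp
  have "en M (u n) \<le> 4 * E + 6" if "N \<le> n" for n M
    using en_add_le[of M "\<lambda>x. u n x - f x" f] N[OF that, of M] f[of M] by simp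
  moreover have "0 \<le> E" using E[of 0] by (simp add: en_def)
  moreover have "en M f \<le> 4 * E + 6" for M using f[of M] \<open>0 \<le> E\<close> by simp
  ultimately show thesis by (intro that[of "4 * E + 6" N]) auto
qed

text \<open>Testing an eigenvector against indicators of single states gives the recurrence.\<close>

lemma friedrichs_imp_recurrence:
  assumes G: "(f, \<lambda>x. l * f x) \<in> friedrichs S m (fin_supp S) A"
  shows "\<And>x. x \<le> k \<Longrightarrow> f x = 0"
    and "\<And>y. k \<le> y \<Longrightarrow> a (Suc y) * (f (Suc (Suc y)) - f (Suc y)) = a y * (f (Suc y) - f y) - l * m (Suc y) * f (Suc y)"
    and "\<exists>E. \<forall>n. en n f \<le> E"
proof -
  obtain u where u: "approx u f" using G by (auto simp: friedrichs_def)
  have lim: "(\<lambda>n. l2_inner S m (A (u n)) (v n)) \<longlonglongrightarrow> l2_inner S m (\<lambda>x. l * f x) g" if "approx v g" for v g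
    using G u that unfolding friedrichs_def by blast
  show "f x = 0" if "x \<le> k" for x using approx_l2[OF u] that by (simp add: l2_iff)
  show "\<exists>E. \<forall>n. en n f \<le> E" using approx_en_bounded[OF u] by metis
  fix y assume y: "k \<le> y"
  define g where "g x = (if x = Suc y then 1 else 0 :: real)" for x
  have g: "g \<in> fin_supp S" using y by (auto simp: fin_supp_def g_def)
  have inner: "l2_inner S m h g = m (Suc y) * h (Suc y)" for h
  proof -
    have "l2_inner S m h g = (\<Sum>z<Suc (Suc y). m (Suc z) * h (Suc z) * g (Suc z))"
      using y by (intro l2_inner_fin_supp) (auto simp: g_def)
    also have "\<dots> = (\<Sum>z<Suc (Suc y). if z = y then m (Suc z) * h (Suc z) else 0)"
      by (intro sum.cong) (auto simp: g_def)
    finally show ?thesis by simp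
  qed
  have "approx (\<lambda>_. g) g"
    using g fin_supp_l2[OF g] inner unfolding form_approx_def
    by (auto simp: l2_inner_def inner[unfolded l2_inner_def])
  from lim[OF this] have "(\<lambda>n. m (Suc y) * A (u n) (Suc y)) \<longlonglongrightarrow> m (Suc y) * (l * f (Suc y))"
    by (simp add: inner)
  moreover have "(\<lambda>n. m (Suc y) * A (u n) (Suc y))
      \<longlonglongrightarrow> a y * (f (Suc y) - f y) - a (Suc y) * (f (Suc (Suc y)) - f (Suc y))"
    unfolding A_eq[OF y] by (intro tendsto_intros approx_pointwise[OF u])
  ultimately have "m (Suc y) * (l * f (Suc y)) = a y * (f (Suc y) - f y) - a (Suc y) * (f (Suc (Suc y)) - f (Suc y))"
    by (rule LIMSEQ_unique)
  then show "a (Suc y) * (f (Suc (Suc y)) - f (Suc y)) = a y * (f (Suc y) - f y) - l * m (Suc y) * f (Suc y)"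
    by (simp add: mult.left_commute)
qed

definition cutoff :: "nat \<Rightarrow> nat \<Rightarrow> real" where
  "cutoff n x = max 0 (min 1 (2 - s x / s (Suc n)))"

text \<open>The cutoff is linear in the scale between the levels \<open>s (Suc n)\<close> and \<open>2 * s (Suc n)\<close>,
  hence its energy is at most \<open>1 / s (Suc n)\<close>, which tends to \<open>0\<close> as the total resistance is
  infinite.\<close>

lemma cutoff_props:
  shows "0 \<le> cutoff n x" "cutoff n x \<le> 1" "x \<le> Suc n \<Longrightarrow> cutoff n x = 1"
    and "\<exists>N. \<forall>x\<ge>N. cutoff n x = 0"
    and "(\<Sum>z<M. a z * (cutoff n (Suc z) - cutoff n z)\<^sup>2) \<le> 1 / s (Suc n)"
proof -
  define t where "t = s (Suc n)"
  have t: "0 < t" by (simp add: t_def s_pos)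
  show bounds: "0 \<le> cutoff n x" "cutoff n x \<le> 1" for x by (auto simp: cutoff_def)
  show "cutoff n x = 1" if "x \<le> Suc n"
    using s_mono[OF that] t by (simp add: cutoff_def t_def min_def divide_le_eq)
  obtain N where "\<forall>x\<ge>N. 2 * t \<le> s x"
    using s_at_top by (auto simp: filterlim_at_top eventually_sequentially)
  then show "\<exists>N. \<forall>x\<ge>N. cutoff n x = 0"
    using t by (intro exI[of _ N]) (auto simp: cutoff_def t_def[symmetric] field_simps)
  have step: "a z * (cutoff n (Suc z) - cutoff n z)\<^sup>2 \<le> (cutoff n z - cutoff n (Suc z)) / t" for z
  proof -
    define d where "d = cutoff n z - cutoff n (Suc z)"
    have "s (Suc z) / t = s z / t + 1 / (a z * t)" using t a_pos[of z] by (simp add: s_Suc field_simps)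
    moreover have "0 < 1 / (a z * t)" using t a_pos[of z] by simp
    ultimately have d: "0 \<le> d" "d \<le> 1 / (a z * t)"
      unfolding d_def cutoff_def t_def[symmetric] by linarith+
    have "a z * (d * d) \<le> a z * (d * (1 / (a z * t)))"
      using d a_pos[of z] by (intro mult_left_mono) auto
    also have "\<dots> = d / t" using a_pos[of z] by simp
    finally show ?thesis by (simp add: d_def power2_commute[of "cutoff n z"] power2_eq_square algebra_simps)
  qed
  have "(\<Sum>z<M. a z * (cutoff n (Suc z) - cutoff n z)\<^sup>2) \<le> (\<Sum>z<M. (cutoff n z - cutoff n (Suc z)) / t)"
    by (intro sum_mono step)
  also have "\<dots> = (cutoff n 0 - cutoff n M) / t"
    by (simp add: sum_divide_distrib[symmetric] sum_lessThan_telescope')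
  also have "\<dots> \<le> 1 / t" using bounds[of 0] bounds[of M] t by (intro divide_right_mono) auto
  finally show "(\<Sum>z<M. a z * (cutoff n (Suc z) - cutoff n z)\<^sup>2) \<le> 1 / s (Suc n)" by (simp add: t_def)
qed

lemma bounded_l2:
  assumes "\<And>x. x \<le> k \<Longrightarrow> f x = 0" "\<And>x. \<bar>f x\<bar> \<le> B"
  shows "f \<in> l2 S m"
proof -
  have "summable (\<lambda>x. m x * (f x)\<^sup>2)"
  proof (rule summable_comparison_test')
    show "summable (\<lambda>x. m x * B\<^sup>2)" by (intro summable_mult2 summable_m)
    show "norm (m x * (f x)\<^sup>2) \<le> m x * B\<^sup>2" for x
      using mult_left_mono[OF power_mono[OF assms(2)[of x] abs_ge_zero, of 2] m_nonneg[of x]] m_nonneg[of x]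
      by simp
  qed
  then show ?thesis using assms(1) by (simp add: l2_iff)
qed

text \<open>Multiply by the cutoffs. The product rule splits the energy of the error into the tail of the
  energy of \<open>f\<close> and the energy of the cutoff, weighted by the bound of \<open>f\<close>.\<close>

lemma exists_approx:
  assumes f0: "\<And>x. x \<le> k \<Longrightarrow> f x = 0" and B: "\<And>x. \<bar>f x\<bar> \<le> B" and E: "\<And>n. en n f \<le> E"
  shows "\<exists>u. approx u f"
proof -
  define u where "u n x = cutoff n x * f x" for n x
  have ufin: "u n \<in> fin_supp S" for n
  proof -
    obtain N where N: "\<forall>x\<ge>N. cutoff n x = 0" using cutoff_props(4) by blast
    have "{x. u n x \<noteq> 0} \<subseteq> {..<N}" using N by (auto simp: u_def not_le[symmetric])
    then show ?thesis using f0 finite_subset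
      by (auto simp: fin_supp_def u_def not_less_eq_eq[symmetric])
  qed
  have fl2: "f \<in> l2 S m" by (rule bounded_l2[OF f0 B])
  have w: "u n x - f x = (cutoff n x - 1) * f x" for n x by (simp add: u_def algebra_simps)
  have w1: "\<bar>cutoff n x - 1\<bar> \<le> 1" for n x using cutoff_props(1,2)[of n x] by simp
  have wB: "\<bar>u n x - f x\<bar> \<le> B" for n x
    unfolding w abs_mult using mult_mono[OF w1[of n x] B[of x]] by simp
  have wl2: "(\<lambda>x. u n x - f x) \<in> l2 S m" for n using ufin by (intro l2_diff fin_supp_l2 fl2)
  define e where "e z = a z * (f (Suc z) - f z)\<^sup>2" for z
  have e0: "0 \<le> e z" for z using a_pos[of z] by (simp add: e_def)
  have esum: "summable e"
  proof (rule bounded_imp_summable[OF e0])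
    show "sum e {..n} \<le> E" for n
      using E[of "Suc n"] unfolding en_def e_def lessThan_Suc_atMost .
  qed
  define \<delta> where "\<delta> n = 2 * (\<Sum>i. e (i + Suc n)) + 2 * (B\<^sup>2 * (1 / s (Suc n)))" for n
  have tail0: "(\<lambda>n. \<Sum>i. g (i + Suc n)) \<longlonglongrightarrow> 0" if "summable g" for g :: "nat \<Rightarrow> real"
  proof -
    have "(\<lambda>n. \<Sum>i. g (i + n)) \<longlonglongrightarrow> 0"
      unfolding LIMSEQ_iff using suminf_exist_split[OF _ that] by auto
    then show ?thesis by (rule LIMSEQ_Suc)
  qed
  have "(\<lambda>n. 1 / s (Suc n)) \<longlonglongrightarrow> 0"
    using tendsto_inverse_0_at_top[OF s_at_top] LIMSEQ_Suc[of "\<lambda>n. inverse (s n)" 0] by (simp add: inverse_eq_divide)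
  then have "\<delta> \<longlonglongrightarrow> 2 * 0 + 2 * (B\<^sup>2 * 0)"
    unfolding \<delta>_def by (intro tendsto_intros tail0 esum)
  then have \<delta>: "\<delta> \<longlonglongrightarrow> 0" by simp
  have en: "en M (\<lambda>x. u n x - f x) \<le> \<delta> n" for n M
  proof -
    have "a z * ((u n (Suc z) - f (Suc z)) - (u n z - f z))\<^sup>2
        \<le> 2 * (if n < z then e z else 0) + 2 * (B\<^sup>2 * (a z * (cutoff n (Suc z) - cutoff n z)\<^sup>2))" for z
    proof -
      define p where "p = (cutoff n (Suc z) - 1) * (f (Suc z) - f z)"
      define q where "q = f z * (cutoff n (Suc z) - cutoff n z)"
      have "a z * ((u n (Suc z) - f (Suc z)) - (u n z - f z))\<^sup>2 = a z * (p + q)\<^sup>2"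
        unfolding w p_def q_def by (simp add: algebra_simps)
      also have "\<dots> \<le> a z * (2 * p\<^sup>2 + 2 * q\<^sup>2)"
        using a_pos[of z] by (intro mult_left_mono square_add_le) auto
      also have "\<dots> = 2 * (a z * p\<^sup>2) + 2 * (a z * q\<^sup>2)" by (simp add: distrib_left)
      also have "a z * p\<^sup>2 \<le> (if n < z then e z else 0)"
      proof (cases "n < z")
        case True
        have "(cutoff n (Suc z) - 1)\<^sup>2 \<le> 1" using w1[of n "Suc z"] by (simp add: abs_square_le_1)
        then have "(cutoff n (Suc z) - 1)\<^sup>2 * e z \<le> 1 * e z" by (intro mult_right_mono e0)
        then show ?thesis using True by (simp add: p_def e_def power_mult_distrib mult_ac)
      next
        case False
        then have "cutoff n (Suc z) = 1" by (intro cutoff_props(3)) simp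
        then show ?thesis using False by (simp add: p_def)
      qed
      also have "a z * q\<^sup>2 \<le> B\<^sup>2 * (a z * (cutoff n (Suc z) - cutoff n z)\<^sup>2)"
      proof -
        have "(f z)\<^sup>2 \<le> B\<^sup>2" using power_mono[OF B[of z] abs_ge_zero, of 2] by simp
        then have "(f z)\<^sup>2 * (a z * (cutoff n (Suc z) - cutoff n z)\<^sup>2) \<le> B\<^sup>2 * (a z * (cutoff n (Suc z) - cutoff n z)\<^sup>2)"
          using a_pos[of z] by (intro mult_right_mono) auto
        then show ?thesis by (simp add: q_def power_mult_distrib mult_ac)
      qed
      finally show ?thesis by simp
    qed
    then have "en M (\<lambda>x. u n x - f x)
        \<le> (\<Sum>z<M. 2 * (if n < z then e z else 0) + 2 * (B\<^sup>2 * (a z * (cutoff n (Suc z) - cutoff n z)\<^sup>2)))"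
      unfolding en_def by (intro sum_mono)
    also have "\<dots> = 2 * (\<Sum>z<M. if n < z then e z else 0) + 2 * (B\<^sup>2 * (\<Sum>z<M. a z * (cutoff n (Suc z) - cutoff n z)\<^sup>2))"
      by (simp add: sum.distrib sum_distrib_left)
    also have "\<dots> \<le> \<delta> n"
      unfolding \<delta>_def
    proof (intro add_mono mult_left_mono cutoff_props(5))
      have "(\<Sum>z<M. if n < z then e z else 0) \<le> (\<Sum>z<Suc n + M. if n < z then e z else 0)"
        using e0 by (intro sum_mono2) auto
      also have "\<dots> = (\<Sum>i<M. e (i + Suc n))"
        by (induction M) (auto simp: add.commute intro!: sum.neutral)
      also have "\<dots> \<le> (\<Sum>i. e (i + Suc n))"
        using e0 by (intro sum_le_suminf summable_ignore_initial_segment[OF esum]) auto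
      finally show "(\<Sum>z<M. if n < z then e z else 0) \<le> (\<Sum>i. e (i + Suc n))" .
    qed auto
    finally show ?thesis .
  qed
  have "approx u f"
    unfolding form_approx_def
  proof (intro conjI allI impI fl2 ufin)
    have "(\<lambda>n. B\<^sup>2 * (\<Sum>i. m (i + Suc n))) \<longlonglongrightarrow> B\<^sup>2 * 0"
      by (intro tendsto_intros tail0 summable_m)
    then have lim: "(\<lambda>n. B\<^sup>2 * (\<Sum>i. m (i + Suc n))) \<longlonglongrightarrow> 0" by simp
    have eq: "l2_inner S m (\<lambda>x. u n x - f x) (\<lambda>x. u n x - f x) = (\<Sum>x. m x * (u n x - f x)\<^sup>2)" for n
      using l2_inner_eq[OF wl2 wl2, of n n] by (simp add: power2_eq_square mult.assoc)
    have "(\<Sum>x. m x * (u n x - f x)\<^sup>2) \<le> B\<^sup>2 * (\<Sum>i. m (i + Suc n))" for n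
    proof -
      have sw: "summable (\<lambda>x. m x * (u n x - f x)\<^sup>2)" using wl2[of n] by (simp add: l2_iff)
      have "(\<Sum>x. m x * (u n x - f x)\<^sup>2)
          = (\<Sum>i. m (i + Suc n) * (u n (i + Suc n) - f (i + Suc n))\<^sup>2) + (\<Sum>x<Suc n. m x * (u n x - f x)\<^sup>2)"
        by (rule suminf_split_initial_segment[OF sw])
      also have "(\<Sum>x<Suc n. m x * (u n x - f x)\<^sup>2) = 0"
        unfolding w using cutoff_props(3)[of _ n] by (intro sum.neutral) auto
      also have "(\<Sum>i. m (i + Suc n) * (u n (i + Suc n) - f (i + Suc n))\<^sup>2) \<le> (\<Sum>i. B\<^sup>2 * m (i + Suc n))"
      proof (rule suminf_le)
        show "m (i + Suc n) * (u n (i + Suc n) - f (i + Suc n))\<^sup>2 \<le> B\<^sup>2 * m (i + Suc n)" for i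
          using mult_right_mono[OF power_mono[OF wB[of n "i + Suc n"] abs_ge_zero, of 2] m_nonneg[of "i + Suc n"]]
          by (simp add: mult.commute)
        show "summable (\<lambda>i. m (i + Suc n) * (u n (i + Suc n) - f (i + Suc n))\<^sup>2)"
          by (rule summable_ignore_initial_segment[OF sw])
        show "summable (\<lambda>i. B\<^sup>2 * m (i + Suc n))"
          by (intro summable_mult summable_ignore_initial_segment[OF summable_m])
      qed
      also have "\<dots> = B\<^sup>2 * (\<Sum>i. m (i + Suc n))"
        by (intro suminf_mult summable_ignore_initial_segment[OF summable_m])
      finally show ?thesis by simp
    qed
    moreover have "0 \<le> (\<Sum>x. m x * (u n x - f x)\<^sup>2)" for n
      using wl2[of n] m_nonneg by (intro suminf_nonneg) (auto simp: l2_iff)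
    ultimately show "(\<lambda>n. l2_inner S m (\<lambda>x. u n x - f x) (\<lambda>x. u n x - f x)) \<longlonglongrightarrow> 0"
      unfolding eq by (intro tendsto_sandwich[OF _ _ tendsto_const lim]) auto
    fix \<epsilon> :: real assume "0 < \<epsilon>"
    then obtain N where N: "\<And>n. N \<le> n \<Longrightarrow> \<delta> n < \<epsilon> / 4"
      using order_tendstoD(2)[OF \<delta>, of "\<epsilon> / 4"] by (auto simp: eventually_sequentially)
    have "l2_inner S m (A (\<lambda>x. u i x - u j x)) (\<lambda>x. u i x - u j x) < \<epsilon>" if "N \<le> i" "N \<le> j" for i j
    proof -
      obtain M where "l2_inner S m (A (\<lambda>x. u i x - u j x)) (\<lambda>x. u i x - u j x) = en M (\<lambda>x. u i x - u j x)"
        using form_eq_en[OF fin_supp_diff[OF ufin ufin]] by blast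
      also have "\<dots> \<le> 2 * \<delta> i + 2 * \<delta> j"
        using en_minus_le[of M "\<lambda>x. u i x - f x" "\<lambda>x. u j x - f x"] en[of M i] en[of M j] by simp
      finally show ?thesis using N[OF that(1)] N[OF that(2)] by simp
    qed
    then show "\<exists>N. \<forall>i\<ge>N. \<forall>j\<ge>N. l2_inner S m (A (\<lambda>x. u i x - u j x)) (\<lambda>x. u i x - u j x) < \<epsilon>" by blast
  qed
  then show ?thesis by blast
qed

lemma l2_Cauchy_Schwarz:
  assumes f: "f \<in> l2 S m" and g: "g \<in> l2 S m"
  shows "(l2_inner S m f g)\<^sup>2 \<le> l2_inner S m f f * l2_inner S m g g"
proof (rule LIMSEQ_le)
  have sm: "summable (\<lambda>x. m x * p x * q x)" if "p \<in> l2 S m" "q \<in> l2 S m" for p q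
    using summable_l2_prod[OF that] by (rule summable_norm_cancel)
  show "(\<lambda>n. (\<Sum>x<n. m x * f x * g x)\<^sup>2) \<longlonglongrightarrow> (l2_inner S m f g)\<^sup>2"
    unfolding l2_inner_eq[OF f g] by (intro tendsto_intros summable_LIMSEQ sm f g)
  show "(\<lambda>n. (\<Sum>x<n. m x * f x * f x) * (\<Sum>x<n. m x * g x * g x)) \<longlonglongrightarrow> l2_inner S m f f * l2_inner S m g g"
    unfolding l2_inner_eq[OF f f] l2_inner_eq[OF g g] by (intro tendsto_intros summable_LIMSEQ sm f g)
  show "\<exists>N. \<forall>n\<ge>N. (\<Sum>x<n. m x * f x * g x)\<^sup>2 \<le> (\<Sum>x<n. m x * f x * f x) * (\<Sum>x<n. m x * g x * g x)"
    using weighted_Cauchy_Schwarz_sum[of "{..<n}" m f g for n] m_nonneg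
    by (intro exI[of _ 0] allI impI) (auto simp: power2_eq_square mult.assoc)
qed

text \<open>Along approximating sequences \<open>u\<close> of \<open>f\<close> and \<open>v\<close> of \<open>g\<close>, the form of \<open>u n\<close> and \<open>v n\<close> may be replaced by
  that of \<open>f\<close> and \<open>v n\<close>, as the energy of \<open>u n - f\<close> tends to \<open>0\<close> and that of \<open>v n\<close> stays bounded. As
  \<open>v n\<close> has finite support, the latter is an inner product with \<open>l * f\<close>, by the recurrence.\<close>

lemma recurrence_imp_friedrichs:
  assumes f0: "\<And>x. x \<le> k \<Longrightarrow> f x = 0"
    and rec: "\<And>y. k \<le> y \<Longrightarrow> a (Suc y) * (f (Suc (Suc y)) - f (Suc y)) = a y * (f (Suc y) - f y) - l * m (Suc y) * f (Suc y)"
    and B: "\<And>x. \<bar>f x\<bar> \<le> B" and E: "\<And>n. en n f \<le> E"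
  shows "(f, \<lambda>x. l * f x) \<in> friedrichs S m (fin_supp S) A"
proof -
  have lf: "(\<lambda>x. l * f x) \<in> l2 S m"
    using f0 B by (intro bounded_l2[of _ "\<bar>l\<bar> * B"]) (auto simp: abs_mult mult_left_mono)
  have Af: "A f x = l * f x" if "x \<in> S" for x
  proof -
    from \<open>x \<in> S\<close> obtain y where y: "x = Suc y" "k \<le> y" by (cases x) auto
    have "m (Suc y) * A f (Suc y) = m (Suc y) * (l * f (Suc y))"
      using A_eq[OF y(2), of f] rec[OF y(2)] by (simp add: mult.left_commute)
    then show ?thesis using m_pos[of "Suc y"] y by simp
  qed
  have "(\<lambda>n. l2_inner S m (A (u n)) (v n)) \<longlonglongrightarrow> l2_inner S m (\<lambda>x. l * f x) g"
    if u: "approx u f" and v: "approx v g" for g u v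
  proof -
    have "(\<lambda>n. l2_inner S m (A (u n)) (v n) - l2_inner S m (A f) (v n)) \<longlonglongrightarrow> 0"
    proof (rule LIMSEQ_I)
      fix r :: real assume r: "0 < r"
      obtain N V where V: "0 \<le> V" "\<And>n M. N \<le> n \<Longrightarrow> en M (v n) \<le> V"
        using approx_en_bounded[OF v] by metis
      define e where "e = (r / 2)\<^sup>2 / (V + 1)"
      have e: "0 < e" using r V by (simp add: e_def)
      obtain N' where N': "\<And>n M. N' \<le> n \<Longrightarrow> en M (\<lambda>x. u n x - f x) \<le> e"
        using approx_en_tendsto[OF u e] by blast
      have "norm (l2_inner S m (A (u n)) (v n) - l2_inner S m (A f) (v n) - 0) < r" if n: "n \<ge> max N N'" for n
      proof -
        have vf: "v n \<in> fin_supp S" by (rule approx_fin[OF v])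
        obtain M where M: "\<And>x. M \<le> x \<Longrightarrow> v n x = 0" using fin_suppE[OF vf] by blast
        let ?w = "\<lambda>x. u n x - f x"
        have "l2_inner S m (A (u n)) (v n) - l2_inner S m (A f) (v n)
            = (\<Sum>z<M. a z * (?w (Suc z) - ?w z) * (v n (Suc z) - v n z))"
          using form_eq[OF vf M, where f = "u n"] form_eq[OF vf M, where f = f]
          by (simp add: sum_subtractf[symmetric] algebra_simps)
        then have "(l2_inner S m (A (u n)) (v n) - l2_inner S m (A f) (v n))\<^sup>2 \<le> en M ?w * en M (v n)"
          using weighted_Cauchy_Schwarz_sum[of "{..<M}" a "\<lambda>z. ?w (Suc z) - ?w z" "\<lambda>z. v n (Suc z) - v n z"] a_pos
          by (simp add: en_def less_imp_le)
        also have "\<dots> \<le> e * V"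
          using N'[of n M] V(2)[of n M] n V(1) e en_mono[of 0 M "v n"]
          by (intro mult_mono) (auto simp: en_def)
        also have "\<dots> \<le> e * (V + 1)" using e by (intro mult_left_mono) auto
        also have "\<dots> = (r / 2)\<^sup>2" using V by (simp add: e_def)
        finally have "\<bar>l2_inner S m (A (u n)) (v n) - l2_inner S m (A f) (v n)\<bar> \<le> \<bar>r / 2\<bar>"
          by (rule abs_le_square_iff[THEN iffD2])
        then show ?thesis using r by simp
      qed
      then show "\<exists>no. \<forall>n\<ge>no. norm (l2_inner S m (A (u n)) (v n) - l2_inner S m (A f) (v n) - 0) < r" by blast
    qed
    moreover have "(\<lambda>n. l2_inner S m (A f) (v n)) \<longlonglongrightarrow> l2_inner S m (\<lambda>x. l * f x) g"
    proof -
      note gl = approx_l2[OF v] and vl = fin_supp_l2[OF approx_fin[OF v]]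
      let ?h = "\<lambda>x. l * f x"
      have diff: "(l2_inner S m (A f) (v n) - l2_inner S m ?h g)\<^sup>2
          \<le> l2_inner S m ?h ?h * l2_inner S m (\<lambda>x. v n x - g x) (\<lambda>x. v n x - g x)" for n
      proof -
        have "l2_inner S m (A f) (v n) = l2_inner S m ?h (v n)"
          unfolding l2_inner_def using Af by (intro infsum_cong) auto
        then have "l2_inner S m (A f) (v n) - l2_inner S m ?h g = (\<Sum>x. m x * ?h x * v n x - m x * ?h x * g x)"
          using suminf_diff[OF summable_norm_cancel[OF summable_l2_prod[OF lf vl[of n]]]
              summable_norm_cancel[OF summable_l2_prod[OF lf gl]]]
          by (simp add: l2_inner_eq lf vl gl)
        also have "\<dots> = l2_inner S m ?h (\<lambda>x. v n x - g x)"
          by (simp add: l2_inner_eq lf vl gl l2_diff right_diff_distrib)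
        finally show ?thesis using l2_Cauchy_Schwarz[OF lf l2_diff[OF vl[of n] gl]] by simp
      qed
      have "(\<lambda>n. l2_inner S m (\<lambda>x. v n x - g x) (\<lambda>x. v n x - g x)) \<longlonglongrightarrow> 0"
        using v by (simp add: form_approx_def)
      from tendsto_mult_left[OF this, of "l2_inner S m ?h ?h"]
      have lim: "(\<lambda>n. l2_inner S m ?h ?h * l2_inner S m (\<lambda>x. v n x - g x) (\<lambda>x. v n x - g x)) \<longlonglongrightarrow> 0"
        by simp
      have "(\<lambda>n. (l2_inner S m (A f) (v n) - l2_inner S m ?h g)\<^sup>2) \<longlonglongrightarrow> 0"
      proof (rule tendsto_sandwich[OF always_eventually always_eventually tendsto_const lim])
        show "\<forall>n. 0 \<le> (l2_inner S m (A f) (v n) - l2_inner S m ?h g)\<^sup>2" by simp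
        show "\<forall>n. (l2_inner S m (A f) (v n) - l2_inner S m ?h g)\<^sup>2
            \<le> l2_inner S m ?h ?h * l2_inner S m (\<lambda>x. v n x - g x) (\<lambda>x. v n x - g x)"
          by (intro allI diff)
      qed
      then have "(\<lambda>n. l2_inner S m (A f) (v n) - l2_inner S m ?h g) \<longlonglongrightarrow> 0"
        by (simp add: power_tendsto_0_iff)
      then show ?thesis by (rule LIM_zero_cancel)
    qed
    ultimately have "(\<lambda>n. (l2_inner S m (A (u n)) (v n) - l2_inner S m (A f) (v n)) + l2_inner S m (A f) (v n))
        \<longlonglongrightarrow> 0 + l2_inner S m (\<lambda>x. l * f x) g" by (rule tendsto_add)
    then show ?thesis by simp
  qed
  moreover have "\<exists>u. approx u f" using f0 B E by (rule exists_approx)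
  ultimately show ?thesis using lf unfolding friedrichs_def by blast
qed

end

section \<open>Eigenvectors of the chain and of the killed chain\<close>

context dirichlet_form
begin

lemma eigenvector_imp_multiple_of_v:
  assumes k: "k = 0" and ev: "is_eigenvector (friedrichs S m (fin_supp S) A) l f"
  obtains c where "c \<noteq> 0" "\<And>x. f x = c * v l x" "flux_limit l = 0"
proof -
  have G: "(f, \<lambda>x. l * f x) \<in> friedrichs S m (fin_supp S) A" and nz: "f \<noteq> (\<lambda>x. 0)"
    using ev by (auto simp: is_eigenvector_def)
  note R = friedrichs_imp_recurrence[OF G]
  define c where "c = a 0 * f 1"
  have fc: "f x = c * v l x" for x
    unfolding c_def using R(1)[of 0] R(2) k by (intro recurrence_imp_multiple_of_v) auto
  have c: "c \<noteq> 0" using nz fc by auto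
  obtain E where E: "\<And>n. en n f \<le> E" using R(3) by blast
  have "en n f = c\<^sup>2 * en n (v l)" for n
    by (simp add: en_def fc sum_distrib_left power_mult_distrib mult.left_commute flip: right_diff_distrib)
  then have "en n (v l) \<le> E / c\<^sup>2" for n
    using E[of n] c by (simp add: field_simps)
  then have "flux_limit l = 0"
    unfolding en_def by (rule flux_limit_zero_if_energy)
  with c fc show thesis by (rule that)
qed

lemma v_eigenvector:
  assumes k: "k = 0" and W: "flux_limit l = 0"
  shows "is_eigenvector (friedrichs S m (fin_supp S) A) l (v l)"
proof -
  obtain B where B: "\<And>x. \<bar>v l x\<bar> \<le> B" using v_bounded[OF W] by blast
  obtain E where E: "\<And>n. en n (v l) \<le> E" using energy_bounded[OF W] unfolding en_def by blast
  have flux: "a y * (v l (Suc y) - v l y) = F l y" for y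
    using a_pos[of y] by (simp add: v_Suc)
  have "(v l, \<lambda>x. l * v l x) \<in> friedrichs S m (fin_supp S) A"
    by (rule recurrence_imp_friedrichs[OF _ _ B E]) (use k in \<open>auto simp: flux F_Suc\<close>)
  moreover have "v l 1 \<noteq> 0" using a_pos[of 0] by (simp add: v_Suc)
  ultimately show ?thesis unfolding is_eigenvector_def by (metis (mono_tags))
qed

lemma eigenvalues_eq_range_ev:
  assumes "k = 0"
  shows "eigenvalues (friedrichs S m (fin_supp S) A) = range ev"
proof (intro equalityI subsetI)
  fix l assume "l \<in> eigenvalues (friedrichs S m (fin_supp S) A)"
  then obtain f where "is_eigenvector (friedrichs S m (fin_supp S) A) l f"
    by (auto simp: eigenvalues_def)
  then have "flux_limit l = 0" using eigenvector_imp_multiple_of_v[OF assms] by blast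
  then show "l \<in> range ev" using flux_limit_zero_is_ev by blast
next
  fix l assume "l \<in> range ev"
  then show "l \<in> eigenvalues (friedrichs S m (fin_supp S) A)"
    using v_eigenvector[OF assms] flux_limit_ev by (auto simp: eigenvalues_def)
qed

lemma eigenvalues_eq_range_killed_ev:
  assumes k: "k = 1"
  shows "eigenvalues (friedrichs S m (fin_supp S) A) = range killed_ev"
proof (intro equalityI subsetI)
  interpret K: entrance_chain "\<lambda>z. a (Suc z)" "\<lambda>x. m (Suc x)" by (rule shifted_chain)
  fix l assume "l \<in> eigenvalues (friedrichs S m (fin_supp S) A)"
  then obtain f where nz: "f \<noteq> (\<lambda>x. 0)" and G: "(f, \<lambda>x. l * f x) \<in> friedrichs S m (fin_supp S) A"
    by (auto simp: eigenvalues_def is_eigenvector_def)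
  note R = friedrichs_imp_recurrence[OF G]
  define c where "c = a (Suc 0) * f (Suc 1)"
  have fc: "f (Suc x) = c * K.v l x" for x
    unfolding c_def using R(1)[of 1] R(2) k by (intro K.recurrence_imp_multiple_of_v[of "\<lambda>x. f (Suc x)"]) auto
  have f0: "f 0 = 0" using R(1) by simp
  have "c \<noteq> 0"
  proof
    assume "c = 0"
    then have "f x = 0" for x using fc f0 by (cases x) auto
    then show False using nz by auto
  qed
  obtain E where E: "\<And>n. en n f \<le> E" using R(3) by blast
  have "c\<^sup>2 * (\<Sum>z<n. a (Suc z) * (K.v l (Suc z) - K.v l z)\<^sup>2) \<le> E" for n
  proof -
    have "c\<^sup>2 * (\<Sum>z<n. a (Suc z) * (K.v l (Suc z) - K.v l z)\<^sup>2)
        = (\<Sum>z<n. a (Suc z) * (f (Suc (Suc z)) - f (Suc z))\<^sup>2)"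
      by (simp add: fc sum_distrib_left power_mult_distrib mult.left_commute flip: right_diff_distrib)
    also have "\<dots> \<le> en (Suc n) f"
      unfolding en_def sum.lessThan_Suc_shift using a_pos[of 0] by simp
    finally show ?thesis using E[of "Suc n"] by simp
  qed
  then have "(\<Sum>z<n. a (Suc z) * (K.v l (Suc z) - K.v l z)\<^sup>2) \<le> E / c\<^sup>2" for n
    using \<open>c \<noteq> 0\<close> by (simp add: field_simps)
  then have "K.flux_limit l = 0" by (rule K.flux_limit_zero_if_energy)
  then show "l \<in> range killed_ev" using K.flux_limit_zero_is_ev by (auto simp: killed_ev_def)
next
  interpret K: entrance_chain "\<lambda>z. a (Suc z)" "\<lambda>x. m (Suc x)" by (rule shifted_chain)
  fix l assume "l \<in> range killed_ev"
  then have W: "K.flux_limit l = 0" using K.flux_limit_ev by (auto simp: killed_ev_def)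
  obtain B where B: "\<And>x. \<bar>K.v l x\<bar> \<le> B" using K.v_bounded[OF W] by blast
  obtain E where E: "\<And>n. (\<Sum>z<n. a (Suc z) * (K.v l (Suc z) - K.v l z)\<^sup>2) \<le> E"
    using K.energy_bounded[OF W] by blast
  define f where "f x = K.v l (x - 1)" for x
  have flux: "a (Suc y) * (K.v l (Suc y) - K.v l y) = K.F l y" for y
    using a_pos[of "Suc y"] by (simp add: K.v_Suc)
  have "(f, \<lambda>x. l * f x) \<in> friedrichs S m (fin_supp S) A"
  proof (rule recurrence_imp_friedrichs)
    show "f x = 0" if "x \<le> k" for x using that k by (simp add: f_def)
    show "\<bar>f x\<bar> \<le> B" for x using B by (simp add: f_def)
    show "a (Suc y) * (f (Suc (Suc y)) - f (Suc y)) = a y * (f (Suc y) - f y) - l * m (Suc y) * f (Suc y)"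
      if y: "k \<le> y" for y
    proof -
      obtain y' where "y = Suc y'" using y k by (cases y) auto
      then show ?thesis by (simp add: f_def flux K.F_Suc)
    qed
    show "en n f \<le> E" for n
    proof -
      have "en n f \<le> en (Suc n) f" by (rule en_mono) simp
      also have "\<dots> = (\<Sum>z<n. a (Suc z) * (K.v l (Suc z) - K.v l z)\<^sup>2)"
        unfolding en_def sum.lessThan_Suc_shift by (simp add: f_def)
      finally show ?thesis using E[of n] by simp
    qed
  qed
  moreover have "f 2 \<noteq> 0" using a_pos[of 1] by (simp add: f_def K.v_Suc)
  ultimately have "is_eigenvector (friedrichs S m (fin_supp S) A) l f"
    unfolding is_eigenvector_def by (metis (mono_tags))
  then show "l \<in> eigenvalues (friedrichs S m (fin_supp S) A)" by (auto simp: eigenvalues_def)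
qed

end

section \<open>The entrance boundary condition\<close>

lemma bd_pi_pos:
  assumes "\<And>x. x \<ge> 1 \<Longrightarrow> b x > 0" "\<And>x. x \<ge> 1 \<Longrightarrow> d x > 0"
  shows "0 < bd_pi b d x"
  unfolding bd_pi_def using assms by (intro divide_pos_pos prod_pos) auto

lemma bd_pi_Suc:
  assumes "\<And>x. x \<ge> 1 \<Longrightarrow> d x > 0" "1 \<le> x"
  shows "bd_pi b d (Suc x) * d (Suc x) = bd_pi b d x * b x"
proof -
  have "(\<Prod>i=2..Suc x. d i) = (\<Prod>i=2..x. d i) * d (Suc x)"
    using assms(2) by (simp add: prod.cl_ivl_Suc)
  moreover have "(\<Prod>i=1..<Suc x. b i) = (\<Prod>i=1..<x. b i) * b x"
    using assms(2) by simp
  moreover have "d (Suc x) \<noteq> 0" using assms(1)[of "Suc x"] by simp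
  ultimately show ?thesis unfolding bd_pi_def by simp
qed

lemma sum_tail_swap:
  fixes c p :: "nat \<Rightarrow> real"
  shows "(\<Sum>x=1..n. c x * (\<Sum>y=x+1..n. p y)) = (\<Sum>y=1..n. p y * (\<Sum>x=1..<y. c x))"
proof (induction n)
  case (Suc n)
  have "(\<Sum>x=1..n. c x * (\<Sum>y=x+1..Suc n. p y)) = (\<Sum>x=1..n. c x * (\<Sum>y=x+1..n. p y) + p (Suc n) * c x)"
    by (intro sum.cong refl) (simp add: algebra_simps)
  also have "\<dots> = (\<Sum>y=1..n. p y * (\<Sum>x=1..<y. c x)) + p (Suc n) * (\<Sum>x=1..n. c x)"
    unfolding sum.distrib Suc.IH by (simp add: sum_distrib_left)
  finally show ?case by (simp add: atLeastLessThanSuc_atLeastAtMost)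
qed simp

lemma sum_le_infsum_ennreal:
  fixes f :: "nat \<Rightarrow> ennreal"
  assumes "finite B" "B \<subseteq> A"
  shows "sum f B \<le> infsum f A"
  using assms by (subst nonneg_infsum_complete) (auto intro: SUP_upper)

text \<open>The second half of the entrance boundary condition bounds, after exchanging the order of
  summation, the sum of mass times scale; its term at \<open>x = 1\<close> alone bounds the total mass. Given
  finite mass, a convergent sum of resistances would contradict the first half.\<close>

lemma entrance_boundary_sums:
  fixes b d :: "nat \<Rightarrow> real"
  assumes b: "\<And>x. x \<ge> 1 \<Longrightarrow> b x > 0" and d: "\<And>x. x \<ge> 1 \<Longrightarrow> d x > 0" and eb: "entrance_boundary b d"
  defines "p \<equiv> bd_pi b d" and "c \<equiv> \<lambda>x. 1 / (bd_pi b d x * b x)"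
  shows "summable p" "summable (\<lambda>y. p y * (\<Sum>x=1..<y. c x))" "\<not> summable c"
proof -
  have p: "0 < p x" for x unfolding p_def by (rule bd_pi_pos[OF b d])
  have c: "0 < c x" if "1 \<le> x" for x using b[OF that] p[of x] by (simp add: c_def p_def)
  define T where "T x = (\<Sum>\<^sub>\<infinity>y\<in>{x+1..}. ennreal (p y))" for x
  define R where "R = enn2real (\<Sum>\<^sub>\<infinity>x\<in>{1..}. ennreal (c x) * T x)"
  have R: "(\<Sum>\<^sub>\<infinity>x\<in>{1..}. ennreal (c x) * T x) = ennreal R"
    using eb unfolding entrance_boundary_def R_def T_def c_def p_def by simp
  have R0: "0 \<le> R" by (simp add: R_def)
  have nonneg: "0 \<le> c x * (\<Sum>y\<in>I. p y)" if "1 \<le> x" for x I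
    using c[OF that] p by (intro mult_nonneg_nonneg sum_nonneg) (auto intro: less_imp_le)
  have conv: "ennreal (c x * (\<Sum>y\<in>I. p y)) = ennreal (c x) * (\<Sum>y\<in>I. ennreal (p y))"
    if "1 \<le> x" for x I
    using c[OF that] p by (subst sum_ennreal) (auto intro: less_imp_le simp: ennreal_mult')
  have partial: "(\<Sum>y=x+1..n. ennreal (p y)) \<le> T x" for x n
    unfolding T_def by (intro sum_le_infsum_ennreal) auto
  have bound: "(\<Sum>x=1..n. c x * (\<Sum>y=x+1..n. p y)) \<le> R" for n
  proof -
    have "ennreal (\<Sum>x=1..n. c x * (\<Sum>y=x+1..n. p y)) = (\<Sum>x=1..n. ennreal (c x) * (\<Sum>y=x+1..n. ennreal (p y)))"
      using nonneg by (subst sum_ennreal[symmetric]) (auto simp: conv[symmetric])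
    also have "\<dots> \<le> (\<Sum>x=1..n. ennreal (c x) * T x)"
      by (intro sum_mono mult_left_mono partial) auto
    also have "\<dots> \<le> (\<Sum>\<^sub>\<infinity>x\<in>{1..}. ennreal (c x) * T x)"
      by (intro sum_le_infsum_ennreal) auto
    finally show ?thesis unfolding R using R0 by (simp add: ennreal_le_iff)
  qed
  show sp: "summable p"
  proof (rule bounded_imp_summable)
    show "0 \<le> p x" for x using p[of x] by simp
    show "(\<Sum>y\<le>n. p y) \<le> p 0 + p 1 + R / c 1" for n
    proof -
      have "c 1 * (\<Sum>y=2..n. p y) \<le> R"
      proof (cases "1 \<le> n")
        case True
        then have "c 1 * (\<Sum>y=1+1..n. p y) \<le> (\<Sum>x=1..n. c x * (\<Sum>y=x+1..n. p y))"
          using nonneg by (intro member_le_sum[of 1 "{1..n}" "\<lambda>x. c x * (\<Sum>y=x+1..n. p y)"]) auto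
        then show ?thesis using bound[of n] by (simp add: numeral_2_eq_2)
      qed (use R0 in auto)
      then have "(\<Sum>y=2..n. p y) \<le> R / c 1" using c[of 1] by (simp add: field_simps)
      moreover have "(\<Sum>y\<le>n. p y) \<le> (\<Sum>y\<in>insert 0 (insert 1 {2..n}). p y)"
        using p by (intro sum_mono2) (auto intro: less_imp_le)
      ultimately show ?thesis by simp
    qed
  qed
  show "summable (\<lambda>y. p y * (\<Sum>x=1..<y. c x))"
  proof (rule bounded_imp_summable)
    show "0 \<le> p y * (\<Sum>x=1..<y. c x)" for y
      using p c by (intro mult_nonneg_nonneg sum_nonneg) (auto intro: less_imp_le)
    show "(\<Sum>y\<le>n. p y * (\<Sum>x=1..<y. c x)) \<le> R" for n
      using bound[of n] unfolding sum_tail_swap by (simp add: atMost_atLeast0 sum.atLeast_Suc_atMost)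
  qed
  show "\<not> summable c"
  proof
    assume sc: "summable c"
    have "(\<Sum>\<^sub>\<infinity>x\<in>{1..}. ennreal (c x) * (\<Sum>y=1..x. ennreal (p y))) \<le> ennreal ((\<Sum>x. c (Suc x)) * suminf p)"
    proof (rule infsum_le_finite_sums[OF nonneg_summable_on_complete])
      fix X :: "nat set" assume X: "finite X" "X \<subseteq> {1..}"
      have scS: "summable (\<lambda>x. c (Suc x))" using sc summable_Suc_iff[of c] by simp
      have le: "(\<Sum>y=1..x. p y) \<le> suminf p" for x
        using p sp by (intro sum_le_suminf) (auto intro: less_imp_le)
      have "(\<Sum>x\<in>X. ennreal (c x) * (\<Sum>y=1..x. ennreal (p y))) = ennreal (\<Sum>x\<in>X. c x * (\<Sum>y=1..x. p y))"
        using X nonneg by (subst sum_ennreal[symmetric]) (auto simp: conv[symmetric] subset_iff)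
      also have "(\<Sum>x\<in>X. c x * (\<Sum>y=1..x. p y)) \<le> (\<Sum>x\<in>X. c x * suminf p)"
        using X c le by (intro sum_mono mult_left_mono) (auto intro: less_imp_le)
      also have "\<dots> = (\<Sum>x\<in>X. c x) * suminf p" by (simp add: sum_distrib_right)
      also have "\<dots> \<le> (\<Sum>x. c (Suc x)) * suminf p"
      proof (rule mult_right_mono)
        have ge: "1 \<le> x" if "x \<in> X" for x using X that by auto
        have "inj_on (\<lambda>x. x - 1) X" by (rule inj_onI) (metis ge le_add_diff_inverse2)
        then have "(\<Sum>x\<in>(\<lambda>x. x - 1) ` X. c (Suc x)) = (\<Sum>x\<in>X. c (Suc (x - 1)))"
          by (simp only: sum.reindex o_def)
        also have "\<dots> = (\<Sum>x\<in>X. c x)" by (rule sum.cong[OF refl]) (metis Suc_diff_1 ge less_eq_Suc_le One_nat_def)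
        finally have "(\<Sum>x\<in>X. c x) = (\<Sum>x\<in>(\<lambda>x. x - 1) ` X. c (Suc x))" ..
        also have "\<dots> \<le> (\<Sum>x. c (Suc x))"
          using X c scS by (intro sum_le_suminf) (auto intro: less_imp_le)
        finally show "(\<Sum>x\<in>X. c x) \<le> (\<Sum>x. c (Suc x))" .
        show "0 \<le> suminf p" using le[of 0] by simp
      qed
      finally show "(\<Sum>x\<in>X. ennreal (c x) * (\<Sum>y=1..x. ennreal (p y))) \<le> ennreal ((\<Sum>x. c (Suc x)) * suminf p)"
        by (simp add: ennreal_leI)
    qed simp
    moreover have "(\<Sum>\<^sub>\<infinity>x\<in>{1..}. ennreal (c x) * (\<Sum>y=1..x. ennreal (p y))) = \<infinity>"
      using eb unfolding entrance_boundary_def c_def p_def by simp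
    ultimately show False by (simp add: top_unique)
  qed
qed

text \<open>By reversibility this is also \<open>bd_eta b d z * b z\<close> for \<open>z \<ge> 1\<close>; the form with \<open>d\<close> covers the
  edge to the absorbing state as well.\<close>

definition bd_conductance :: "(nat \<Rightarrow> real) \<Rightarrow> (nat \<Rightarrow> real) \<Rightarrow> nat \<Rightarrow> real" where
  "bd_conductance b d z = bd_eta b d (Suc z) * d (Suc z)"

lemma entrance_boundary_dirichlet_form:
  fixes b d :: "nat \<Rightarrow> real"
  assumes b: "\<And>x. x \<ge> 1 \<Longrightarrow> b x > 0" and d: "\<And>x. x \<ge> 1 \<Longrightarrow> d x > 0" and eb: "entrance_boundary b d"
  shows "dirichlet_form (bd_conductance b d) (bd_eta b d) k (minus_K0 b d {Suc k..})"
proof -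
  define p where "p = bd_pi b d"
  define c where "c = (\<lambda>x. 1 / (bd_pi b d x * b x))"
  define Z where "Z = (\<Sum>\<^sub>\<infinity>y\<in>{1..}. p y)"
  define a where "a = bd_conductance b d"
  define m where "m = bd_eta b d"
  note sums = entrance_boundary_sums[OF b d eb, folded c_def p_def]
  have p: "0 < p x" for x unfolding p_def by (rule bd_pi_pos[OF b d])
  have "p summable_on {1..}"
    using sums(1) p by (intro summable_on_subset_banach[of p UNIV "{1..}"])
      (auto simp: summable_on_UNIV_nonneg_real_iff less_imp_le)
  then have "(\<Sum>y\<in>{1}. p y) \<le> Z"
    unfolding Z_def using p by (intro finite_sum_le_infsum) (auto intro: less_imp_le)
  then have Z: "0 < Z" using p[of 1] by simp
  have m_eq: "m x = p x / Z" for x by (simp add: m_def bd_eta_def p_def Z_def)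
  have m: "0 < m x" for x using p[of x] Z by (simp add: m_eq)
  have a0: "0 < a z" for z using m[of "Suc z"] d[of "Suc z"] by (simp add: a_def bd_conductance_def m_def)
  have a_Suc: "a (Suc z) = m (Suc z) * b (Suc z)" for z
    using bd_pi_Suc[where d = d and x = "Suc z" and b = b] d by (simp add: a_def bd_conductance_def m_def bd_eta_def)
  have inv: "1 / a z = Z * c z" if "1 \<le> z" for z
  proof -
    obtain z' where "z = Suc z'" using \<open>1 \<le> z\<close> by (cases z) auto
    then show ?thesis using Z by (simp add: a_Suc m_eq c_def p_def)
  qed
  have chain: "entrance_chain a m"
  proof
    show "0 < a z" "0 < m z" for z by (rule a0, rule m)
    show "\<not> summable (\<lambda>z. 1 / a z)"
    proof
      assume "summable (\<lambda>z. 1 / a z)"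
      then have "summable (\<lambda>z. 1 / a (Suc z))" using summable_Suc_iff[of "\<lambda>z. 1 / a z"] by simp
      then have "summable (\<lambda>z. (1 / Z) * (1 / a (Suc z)))" by (rule summable_mult)
      then have "summable (\<lambda>z. c (Suc z))" using Z by (simp add: inv)
      then show False using sums(3) summable_Suc_iff[of c] by simp
    qed
    show "summable (\<lambda>x. m x * (\<Sum>z<x. 1 / a z))"
    proof (rule summable_comparison_test')
      show "summable (\<lambda>x. (1 / a 0) * (p x / Z) + p x * (\<Sum>z=1..<x. c z))"
        by (intro summable_add summable_mult summable_divide sums)
      show "norm (m x * (\<Sum>z<x. 1 / a z)) \<le> (1 / a 0) * (p x / Z) + p x * (\<Sum>z=1..<x. c z)"
        if "x \<ge> 1" for x
      proof -
        have "(\<Sum>z<x. 1 / a z) = 1 / a 0 + (\<Sum>z=1..<x. 1 / a z)"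
          using that by (simp add: lessThan_atLeast0 sum.atLeast_Suc_lessThan)
        also have "(\<Sum>z=1..<x. 1 / a z) = Z * (\<Sum>z=1..<x. c z)"
          unfolding sum_distrib_left by (intro sum.cong) (auto simp: inv)
        finally have "m x * (\<Sum>z<x. 1 / a z) = (1 / a 0) * (p x / Z) + p x * (\<Sum>z=1..<x. c z)"
          using Z by (simp add: m_eq distrib_left)
        moreover have "0 \<le> m x * (\<Sum>z<x. 1 / a z)"
          using m a0 by (intro mult_nonneg_nonneg sum_nonneg) (auto intro: less_imp_le)
        ultimately show ?thesis by simp
      qed
    qed
  qed
  have gen: "bd_apply b d f (Suc y) = d (Suc y) * (f y - f (Suc y)) + b (Suc y) * (f (Suc (Suc y)) - f (Suc y))" for f y
  proof -
    have "bd_apply b d f (Suc y) = (\<Sum>z\<in>{y, Suc y, Suc (Suc y)}. bd_generator b d (Suc y) z * f z)"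
      unfolding bd_apply_def by (rule sum.mono_neutral_right) (auto simp: bd_generator_def)
    then show ?thesis by (simp add: bd_generator_def algebra_simps)
  qed
  have "dirichlet_form a m k (minus_K0 b d {Suc k..})"
  proof (intro dirichlet_form.intro chain dirichlet_form_axioms.intro)
    fix f :: "nat \<Rightarrow> real" and y assume y: "k \<le> y"
    have "m (Suc y) * minus_K0 b d {Suc k..} f (Suc y)
        = (m (Suc y) * d (Suc y)) * (f (Suc y) - f y) - (m (Suc y) * b (Suc y)) * (f (Suc (Suc y)) - f (Suc y))"
      using y by (simp add: minus_K0_def gen algebra_simps)
    also have "m (Suc y) * d (Suc y) = a y" by (simp add: a_def bd_conductance_def m_def)
    also have "m (Suc y) * b (Suc y) = a (Suc y)" by (simp add: a_Suc)
    finally show "m (Suc y) * minus_K0 b d {Suc k..} f (Suc y)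
        = a y * (f (Suc y) - f y) - a (Suc y) * (f (Suc (Suc y)) - f (Suc y))" .
  qed
  then show ?thesis by (simp add: a_def m_def)
qed

lemma strict_mono_range_unique:
  fixes f g :: "nat \<Rightarrow> real"
  assumes f: "strict_mono f" and g: "strict_mono g" and range: "range f = range g"
  shows "f = g"
proof -
  have le: "g n \<le> f n" if "strict_mono f" "strict_mono g" "range f \<subseteq> range g" for f g :: "nat \<Rightarrow> real" and n
  proof -
    have "\<forall>n. \<exists>h. f n = g h" using that(3) by blast
    then obtain h where h: "\<And>n. f n = g (h n)" by metis
    have "strict_mono h"
      using that(1,2) by (auto simp: strict_mono_Suc_iff[of h] h[symmetric] strict_mono_less[OF that(2), symmetric] strict_mono_Suc_iff[of f])
    then have "n \<le> h n" by (rule strict_mono_imp_increasing)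
    then show ?thesis using that(2) by (simp add: h strict_mono_less_eq)
  qed
  show ?thesis
    using le[OF f g] le[OF g f] range by (intro ext order_antisym) auto
qed

theorem theorem4:
  fixes b d :: "nat \<Rightarrow> real" and lam :: "nat \<Rightarrow> real" and lam' :: real and \<phi> :: "nat \<Rightarrow> real"
  assumes "b 0 = 0" and "d 0 = 0"
    and "\<And>x. x \<ge> 1 \<Longrightarrow> b x > 0" and "\<And>x. x \<ge> 1 \<Longrightarrow> d x > 0"
    and "entrance_boundary b d"
    and "strict_mono lam" and "range lam = eigenvalues (minus_K b d {1..})"
    and "lam' \<in> eigenvalues (minus_K b d ({1..} - {1}))"
    and "\<And>\<mu>. \<mu> \<in> eigenvalues (minus_K b d ({1..} - {1})) \<Longrightarrow> lam' \<le> \<mu>"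
    and "is_eigenvector (minus_K b d {1..}) (lam 0) \<phi>"
  shows "lam' > lam 0 \<and>
    summable (\<lambda>n. 1 / lam n) \<and>
    convergent_prod (\<lambda>n. 1 - lam 0 / lam (Suc n)) \<and>
    (1 - lam 0 / lam') * (\<Prod>n. 1 - lam 0 / lam (Suc n)) > 0 \<and>
    (\<exists>s\<in>{1, -1}. \<exists>\<psi>. \<psi> = (\<lambda>x. s * \<phi> x) \<and>
       \<psi> 0 = 0 \<and> strict_mono \<psi> \<and> bounded (range \<psi>) \<and> convergent \<psi> \<and>
       (SUP x\<in>{1..}. \<psi> x) / (INF y\<in>{1..}. \<psi> y) = lim \<psi> / \<psi> 1 \<and>
       lim \<psi> / \<psi> 1 \<le> inverse ((1 - lam 0 / lam') * (\<Prod>n. 1 - lam 0 / lam (Suc n))))"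
proof -
  interpret dirichlet_form "bd_conductance b d" "bd_eta b d" 0 "minus_K0 b d {Suc 0..}"
    using assms(3-5) by (rule entrance_boundary_dirichlet_form)
  interpret D1: dirichlet_form "bd_conductance b d" "bd_eta b d" 1 "minus_K0 b d {Suc 1..}"
    using assms(3-5) by (rule entrance_boundary_dirichlet_form)
  have K: "minus_K b d {1..} = friedrichs {Suc 0..} (bd_eta b d) (fin_supp {Suc 0..}) (minus_K0 b d {Suc 0..})"
    by (simp add: minus_K_def)
  have "{1..} - {1} = {Suc 1..}" by auto
  then have K1: "minus_K b d ({1..} - {1})
      = friedrichs {Suc 1..} (bd_eta b d) (fin_supp {Suc 1..}) (minus_K0 b d {Suc 1..})"
    by (simp only: minus_K_def)
  have "range lam = range ev" using assms(7) unfolding K eigenvalues_eq_range_ev[OF refl] .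
  then have lam: "lam = ev" by (rule strict_mono_range_unique[OF assms(6) strict_mono_ev])
  have r1: "eigenvalues (minus_K b d ({1..} - {1})) = range killed_ev"
    unfolding K1 by (rule D1.eigenvalues_eq_range_killed_ev) simp
  have lam': "lam' = killed_ev 0"
  proof (rule antisym)
    show "lam' \<le> killed_ev 0" using assms(9) unfolding r1 by blast
    interpret Kc: entrance_chain "\<lambda>z. bd_conductance b d (Suc z)" "\<lambda>x. bd_eta b d (Suc x)"
      by (rule shifted_chain)
    obtain j where "lam' = killed_ev j" using assms(8) unfolding r1 by blast
    then show "killed_ev 0 \<le> lam'"
      using Kc.strict_mono_ev by (simp add: killed_ev_def strict_mono_less_eq)
  qed
  obtain c where c: "c \<noteq> 0" "\<And>x. \<phi> x = c * v (ev 0) x"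
    using eigenvector_imp_multiple_of_v[OF refl] assms(10) unfolding K lam by metis
  define \<psi> where "\<psi> = (\<lambda>x. sgn c * \<phi> x)"
  have \<psi>: "\<psi> x = \<bar>c\<bar> * v (ev 0) x" for x
    by (simp add: \<psi>_def c(2) abs_sgn mult.assoc[symmetric] mult.commute)
  have "0 < \<bar>c\<bar>" using c by simp
  note amp = ground_state_amplitude[OF this \<psi>]
  have "0 < 1 - ev 0 / killed_ev 0" using ev_less_killed_ev ev_pos[of 0] by simp
  then have "0 < (1 - ev 0 / killed_ev 0) * (\<Prod>k. 1 - ev 0 / ev (Suc k))"
    using prodinf_ev_pos by (rule mult_pos_pos)
  moreover have "sgn c \<in> {1, -1}" using c by (auto simp: sgn_if)
  moreover have "\<psi> 0 = 0" by (simp add: \<psi>)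
  ultimately show ?thesis
    unfolding lam lam'
    using ev_less_killed_ev summable_inverse_ev convergent_prod_ev amp \<psi>_def
    by (intro conjI bexI[of _ "sgn c"] exI[of _ \<psi>])
qed

end
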